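(* Let $\mathcal{O}\subset\mathfrak{sl}_n(\mathbb{C})$ be a conjugacy class of matrices with simple spectrum, let $\Lambda=\mathrm{diag}(\lambda_1,\dots,\lambda_n)\in\mathcal{O}$, and let $\varphi:\mathcal{U}\to(\Lambda+\mathfrak{l})\times(\Lambda+\mathfrak{l})$, $X\mapsto(Y,Z)$, be the $(Y,Z)$ variables centered at $\Lambda$. Then $\varphi$ transforms the Toda vector field on $\mathcal{U}$ into $$(Y',Z')=\big([Y,i\,\mathrm{Im}\Lambda],\,[Z,-\mathrm{Re}\Lambda]\big).$$ This linear vector field (i) is defined on the entire affine space $(\Lambda+\mathfrak{l})\times(\Lambda+\mathfrak{l})$; (ii) has trajectories whose first projection has compact closure and whose second projection is compact if and only if it is stationary; (iii) decouples in the strictly lower triangular entries $Y_{jk},Z_{\ell m}$ of $Y$ and $Z$.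
   Context: Work in $\mathrm{SL}_n(\mathbb{C})$. The Toda vector field on $\mathfrak{sl}_n(\mathbb{C})$ is $X'=[X,\pi_{\mathfrak{k}}X]$, with $\pi_{\mathfrak{k}}$ the projection onto traceless skew-Hermitian matrices along traceless upper triangular matrices with real diagonal. Let $\mathrm{K}=\mathrm{SU}(n)$, $\mathrm{U}$ the upper triangular determinant one matrices with positive diagonal, $\mathrm{L}$ the lower unipotent triangular matrices, $\mathfrak{l}$ the strictly lower triangular matrices; each $g$ factors uniquely $g=\kappa(g)\nu(g)$ with $\kappa(g)\in\mathrm{K}$, $\nu(g)\in\mathrm{U}$; $\mathcal{C}=\kappa(\mathrm{L})$, $\mathcal{D}=\nu(\mathrm{L})$; $X^g=gXg^{-1}$. Set $\mathcal{U}=\{\Lambda^{(lk)^{-1}}:k\in\mathcal{C},l\in\mathrm{L}\}\subset\mathcal{O}$ (open dense). The $(Y,Z)$ variables are $\varphi(X)=(\Lambda^{l_1^{-1}},\Lambda^{l_2^{-1}})$ where $X=\Lambda^{(l_1k)^{-1}}=\Lambda^{ul_2^{-1}}$ with unique $k\in\mathcal{C}$, $u\in\mathcal{D}$, $l_1,l_2\in\mathrm{L}$; $\varphi$ is a diffeomorphism onto $(\Lambda+\mathfrak{l})\times(\Lambda+\mathfrak{l})$. *)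

theory Defs
  imports "HOL-Analysis.Analysis"
begin

text \<open>Complex n x n matrices are \<open>complex^'n^'n\<close>, indexed by a finite linearly
  ordered type \<open>'n\<close> (row index first: \<open>A $ i $ j\<close>).\<close>

type_synonym 'n cmat = "complex^'n^'n"

definition comm :: "'n::finite cmat \<Rightarrow> 'n cmat \<Rightarrow> 'n cmat" where
  "comm A B = A ** B - B ** A"

definition adj :: "'n::finite cmat \<Rightarrow> 'n cmat" where
  "adj A = (\<chi> i j. cnj (A $ j $ i))"

definition diagm :: "('n::finite \<Rightarrow> complex) \<Rightarrow> 'n cmat" where
  "diagm d = (\<chi> i j. if i = j then d i else 0)"

definition sl :: "'n::finite cmat set" where
  "sl = {X. trace X = 0}"

definition SLn :: "'n::finite cmat set" where
  "SLn = {g. det g = 1}"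

definition conjm :: "'n::finite cmat \<Rightarrow> 'n cmat \<Rightarrow> 'n cmat" where
  "conjm g X = g ** X ** matrix_inv g"

definition su :: "'n::finite cmat set" where
  "su = {K. adj K = - K \<and> trace K = 0}"

definition bor :: "'n::{finite,linorder} cmat set" where
  "bor = {B. (\<forall>i j. j < i \<longrightarrow> B $ i $ j = 0) \<and> (\<forall>i. Im (B $ i $ i) = 0) \<and> trace B = 0}"

definition pik :: "'n::{finite,linorder} cmat \<Rightarrow> 'n cmat" where
  "pik X = (THE K. K \<in> su \<and> X - K \<in> bor)"

definition toda :: "'n::{finite,linorder} cmat \<Rightarrow> 'n cmat" where
  "toda X = comm X (pik X)"

definition SUn :: "'n::finite cmat set" where
  "SUn = {k. k ** adj k = mat 1 \<and> det k = 1}"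

definition Ugrp :: "'n::{finite,linorder} cmat set" where
  "Ugrp = {u. (\<forall>i j. j < i \<longrightarrow> u $ i $ j = 0) \<and>
              (\<forall>i. Im (u $ i $ i) = 0 \<and> Re (u $ i $ i) > 0) \<and> det u = 1}"

definition Lgrp :: "'n::{finite,linorder} cmat set" where
  "Lgrp = {l. (\<forall>i j. i < j \<longrightarrow> l $ i $ j = 0) \<and> (\<forall>i. l $ i $ i = 1)}"

definition lalg :: "'n::{finite,linorder} cmat set" where
  "lalg = {A. \<forall>i j. i \<le> j \<longrightarrow> A $ i $ j = 0}"

definition kappa :: "'n::{finite,linorder} cmat \<Rightarrow> 'n cmat" where
  "kappa g = fst (THE p. fst p \<in> SUn \<and> snd p \<in> Ugrp \<and> g = fst p ** snd p)"

definition nu :: "'n::{finite,linorder} cmat \<Rightarrow> 'n cmat" where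
  "nu g = snd (THE p. fst p \<in> SUn \<and> snd p \<in> Ugrp \<and> g = fst p ** snd p)"

definition Cset :: "'n::{finite,linorder} cmat set" where
  "Cset = kappa ` Lgrp"

definition Dset :: "'n::{finite,linorder} cmat set" where
  "Dset = nu ` Lgrp"

definition aff :: "'n::{finite,linorder} cmat \<Rightarrow> 'n cmat set" where
  "aff Lam = {Lam + A | A. A \<in> lalg}"

definition Uset :: "'n::{finite,linorder} cmat \<Rightarrow> 'n cmat set" where
  "Uset Lam = {conjm (matrix_inv (l ** k)) Lam | l k. k \<in> Cset \<and> l \<in> Lgrp}"

definition phiYZ :: "'n::{finite,linorder} cmat \<Rightarrow> 'n cmat \<Rightarrow> 'n cmat \<times> 'n cmat" where
  "phiYZ Lam X = (THE p. \<exists>k u l1 l2. k \<in> Cset \<and> u \<in> Dset \<and> l1 \<in> Lgrp \<and> l2 \<in> Lgrp \<and>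
      X = conjm (matrix_inv (l1 ** k)) Lam \<and> X = conjm (u ** matrix_inv l2) Lam \<and>
      p = (conjm (matrix_inv l1) Lam, conjm (matrix_inv l2) Lam))"

definition linYZ :: "('n::finite \<Rightarrow> complex) \<Rightarrow> 'n cmat \<times> 'n cmat \<Rightarrow> 'n cmat \<times> 'n cmat" where
  "linYZ lam p = (comm (fst p) (diagm (\<lambda>j. \<i> * complex_of_real (Im (lam j)))),
                  comm (snd p) (- diagm (\<lambda>j. complex_of_real (Re (lam j)))))"

end

theory Submission
  imports Defs
begin

text \<open>Write \<open>X\<^sub>0 = g\<^sup>-\<^sup>1 \<Lambda> g\<close> with \<open>g = l k\<^sub>0\<close> and \<open>k\<^sub>0 u\<^sub>0 = m\<close> lower unipotent. The Toda flow is solved by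
  factorization: if \<open>Q' = Q \<pi>(X)\<close> with \<open>Q = 1\<close> at time \<open>0\<close>, then \<open>Q\<close> is unitary, \<open>Q X Q\<^sup>-\<^sup>1 = X\<^sub>0\<close>, and
  \<open>R = Q\<^sup>-\<^sup>1 exp(t X\<^sub>0)\<close> is upper triangular with positive diagonal. Since \<open>exp(t X\<^sub>0) = g\<^sup>-\<^sup>1 exp(t \<Lambda>) g\<close>,
  split \<open>exp(t \<Lambda>) = V P\<close> into its unitary part \<open>V = exp(i t Im \<Lambda>)\<close> and positive part \<open>P = exp(t Re \<Lambda>)\<close>.
  Then \<open>X = (l\<^sub>1 k)\<^sup>-\<^sup>1 \<Lambda> (l\<^sub>1 k)\<close> with \<open>l\<^sub>1 = V\<^sup>-\<^sup>1 l V\<close>, \<open>k = V\<^sup>-\<^sup>1 k\<^sub>0 Q\<close>, and \<open>k u = l\<^sub>1\<^sup>-\<^sup>1 l\<^sub>2\<close> for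
  \<open>u = R u\<^sub>0 P\<^sup>-\<^sup>1\<close>, \<open>l\<^sub>2 = P l m P\<^sup>-\<^sup>1\<close>; so \<open>Y\<close> and \<open>Z\<close> evolve by conjugation with \<open>V\<^sup>-\<^sup>1\<close> and \<open>P\<close>.
  Uniqueness of the \<open>(Y, Z)\<close> variables reduces to uniqueness of the Cholesky factorization, as the
  centralizer of \<open>\<Lambda>\<close> is diagonal.\<close>

section \<open>Triangular and diagonal matrices\<close>

text \<open>In finite dimension bilinearity already gives boundedness. The instance supplies the
  product rule, continuity of products, and a constant \<open>K\<close> for norm estimates; the
  vector norm on matrices is not assumed to be submultiplicative.\<close>

lemma bounded_bilinear_matrix_mult:
  "bounded_bilinear ((**) :: 'n::finite cmat \<Rightarrow> 'n cmat \<Rightarrow> 'n cmat)"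
proof -
  have "bilinear ((**) :: 'n cmat \<Rightarrow> 'n cmat \<Rightarrow> 'n cmat)"
    unfolding bilinear_def linear_iff
    by (auto simp: vec_eq_iff matrix_matrix_mult_def sum.distrib algebra_simps scaleR_sum_right)
  then show ?thesis
    by (simp add: bilinear_conv_bounded_bilinear)
qed

lemmas has_vector_derivative_matrix_mult =
  bounded_bilinear.has_vector_derivative[OF bounded_bilinear_matrix_mult]

lemma matrix_diff_distribs:
  fixes A B C :: "'n::finite cmat"
  shows "A ** (B - C) = A ** B - A ** C" "(A - B) ** C = A ** C - B ** C"
    "A ** (- B) = - (A ** B)" "(- A) ** B = - (A ** B)"
  by (simp_all add: vec_eq_iff matrix_matrix_mult_def algebra_simps sum_subtractf sum_negf)

lemma matrix_inv_eqI:
  fixes A :: "'n::finite cmat"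
  assumes "A ** B = mat 1"
  shows "matrix_inv A = B"
proof -
  have BA: "B ** A = mat 1"
    using assms matrix_left_right_inverse by blast
  have "A ** matrix_inv A = mat 1 \<and> matrix_inv A ** A = mat 1"
    unfolding matrix_inv_def by (rule someI[of _ B]) (simp add: assms BA)
  then show ?thesis
    by (metis BA matrix_mul_assoc matrix_mul_lid matrix_mul_rid)
qed

lemma
  fixes A :: "'n::finite cmat"
  assumes "det A \<noteq> 0"
  shows matrix_inv_right: "A ** matrix_inv A = mat 1"
    and matrix_inv_left: "matrix_inv A ** A = mat 1"
proof -
  obtain B where "A ** B = mat 1"
    using assms invertible_det_nz[of A] invertible_def by blast
  then show "A ** matrix_inv A = mat 1"
    using matrix_inv_eqI by blast
  then show "matrix_inv A ** A = mat 1"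
    using matrix_left_right_inverse by blast
qed

lemma matrix_inv_inv:
  fixes A :: "'n::finite cmat"
  assumes "det A \<noteq> 0"
  shows "matrix_inv (matrix_inv A) = A"
  by (intro matrix_inv_eqI matrix_inv_left assms)

lemma matrix_inv_mult:
  fixes A B :: "'n::finite cmat"
  assumes "det A \<noteq> 0" "det B \<noteq> 0"
  shows "matrix_inv (A ** B) = matrix_inv B ** matrix_inv A"
proof (rule matrix_inv_eqI)
  have "(A ** B) ** (matrix_inv B ** matrix_inv A) = A ** (B ** matrix_inv B) ** matrix_inv A"
    by (simp add: matrix_mul_assoc)
  then show "(A ** B) ** (matrix_inv B ** matrix_inv A) = mat 1"
    by (simp add: matrix_inv_right assms)
qed

lemma matrix_inv_cancel:
  fixes A B :: "'n::finite cmat"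
  assumes "det A \<noteq> 0"
  shows "A ** (matrix_inv A ** B) = B" "matrix_inv A ** (A ** B) = B"
    "(B ** A) ** matrix_inv A = B" "(B ** matrix_inv A) ** A = B"
  by (simp_all add: matrix_mul_assoc matrix_inv_right[OF assms] matrix_inv_left[OF assms])
    (simp_all add: matrix_inv_right[OF assms] matrix_inv_left[OF assms] flip: matrix_mul_assoc)

section \<open>Adjoints and diagonal matrices\<close>

lemma adj_mult: "adj (A ** B) = adj B ** adj A"
  by (simp add: adj_def vec_eq_iff matrix_matrix_mult_def mult.commute)

lemma adj_adj [simp]: "adj (adj A) = A"
  by (simp add: adj_def vec_eq_iff)

lemma adj_mat1 [simp]: "adj (mat 1) = mat 1"
  by (auto simp: adj_def vec_eq_iff mat_def)

lemma det_adj: "det (adj A) = cnj (det A)"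
proof -
  have "adj A = transpose (\<chi> i j. cnj (A $ i $ j))"
    by (simp add: adj_def transpose_def vec_eq_iff)
  then have "det (adj A) = det (\<chi> i j. cnj (A $ i $ j))"
    by simp
  also have "\<dots> = cnj (det A)"
    by (simp add: det_def)
  finally show ?thesis .
qed

lemma diagm_mult_nth [simp]:
  "(diagm d ** A) $ i $ j = d i * A $ i $ j"
  "(A ** diagm d) $ i $ j = A $ i $ j * d j"
  by (simp_all add: diagm_def matrix_matrix_mult_def if_distrib if_distribR cong: if_cong)

lemma diagm_nth: "diagm d $ i $ j = (if i = j then d i else 0)"
  by (simp add: diagm_def)

lemma diagm_mult: "diagm d ** diagm e = diagm (\<lambda>i. d i * e i)"
  by (simp add: vec_eq_iff diagm_nth)

lemma diagm_one: "diagm (\<lambda>i. 1) = mat 1"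
  by (simp add: diagm_def mat_def)

lemma det_diagm: "det (diagm d) = (\<Prod>i\<in>UNIV. d i)"
  by (subst det_diagonal) (simp_all add: diagm_def)

lemma adj_diagm: "adj (diagm d) = diagm (\<lambda>i. cnj (d i))"
  by (auto simp: adj_def diagm_def vec_eq_iff)

text \<open>Comparing entries gives \<open>A $ i $ j * (lam j - lam i) = 0\<close>. This is where
  simplicity of the spectrum enters.\<close>

lemma commutes_diagm_imp_diagonal:
  assumes "inj lam" and "A ** diagm lam = diagm lam ** A"
  shows "A = diagm (\<lambda>i. A $ i $ i)"
proof -
  have "A $ i $ j = 0" if "i \<noteq> j" for i j
  proof -
    have "A $ i $ j * lam j = lam i * A $ i $ j"
      using assms(2) by (metis diagm_mult_nth)
    then show ?thesis
      using assms(1) that by (auto simp: inj_def)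
  qed
  then show ?thesis
    by (simp add: vec_eq_iff diagm_def)
qed

section \<open>Triangular matrices over a finite linear order\<close>

definition lowtri :: "'n::{finite,linorder} cmat \<Rightarrow> bool" where
  "lowtri A \<longleftrightarrow> (\<forall>i j. i < j \<longrightarrow> A $ i $ j = 0)"

definition uptri :: "'n::{finite,linorder} cmat \<Rightarrow> bool" where
  "uptri A \<longleftrightarrow> (\<forall>i j. j < i \<longrightarrow> A $ i $ j = 0)"

definition posdiag :: "'n::finite cmat \<Rightarrow> bool" where
  "posdiag A \<longleftrightarrow> (\<forall>i. Im (A $ i $ i) = 0 \<and> Re (A $ i $ i) > 0)"

text \<open>Finiteness makes the order well founded: the number of elements below \<open>i\<close>
  strictly decreases when passing to a smaller element.\<close>

lemma finite_linorder_induct: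
  fixes i :: "'n::{finite,linorder}"
  assumes "\<And>i. (\<And>j. j < i \<Longrightarrow> P j) \<Longrightarrow> P i"
  shows "P i"
proof (induction i rule: measure_induct_rule[where f = "\<lambda>i. card {..<i}"])
  case (less i)
  have "P j" if "j < i" for j
    using that by (intro less psubset_card_mono) auto
  then show ?case
    by (rule assms)
qed

lemma lowtri_transpose: "lowtri (transpose A) = uptri A"
  by (auto simp: uptri_def lowtri_def transpose_def)

lemma uptri_adj: "uptri (adj A) = lowtri A"
  by (auto simp: uptri_def lowtri_def adj_def)

lemma lowtri_adj: "lowtri (adj A) = uptri A"
  by (auto simp: uptri_def lowtri_def adj_def)

lemma posdiag_adj: "posdiag (adj A) = posdiag A"
  by (simp add: posdiag_def adj_def)

lemma lowtri_diagm [simp]: "lowtri (diagm d)" and uptri_diagm [simp]: "uptri (diagm d)"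
  by (auto simp: lowtri_def uptri_def diagm_def)

lemma lowtri_uptri_eq_diagm: "lowtri A \<Longrightarrow> uptri A \<Longrightarrow> A = diagm (\<lambda>i. A $ i $ i)"
  by (auto simp: lowtri_def uptri_def diagm_def vec_eq_iff) (meson linorder_neqE)

lemma
  assumes "lowtri A" "lowtri B"
  shows lowtri_mult: "lowtri (A ** B)"
    and lowtri_mult_diag: "(A ** B) $ i $ i = A $ i $ i * B $ i $ i"
proof -
  show "lowtri (A ** B)"
    unfolding lowtri_def matrix_matrix_mult_def
    using assms by (auto simp: lowtri_def intro!: sum.neutral) (meson linorder_not_less order.strict_trans1)
  have "(A ** B) $ i $ i = (\<Sum>k\<in>UNIV. if k = i then A $ i $ i * B $ i $ i else 0)"
  proof -
    have "A $ i $ k * B $ k $ i = 0" if "k \<noteq> i" for k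
      using assms that by (cases "k < i") (auto simp: lowtri_def)
    then have eq: "A $ i $ k * B $ k $ i = (if k = i then A $ i $ i * B $ i $ i else 0)" for k
      by auto
    show ?thesis
      unfolding matrix_matrix_mult_def vec_lambda_beta by (rule sum.cong[OF refl eq])
  qed
  then show "(A ** B) $ i $ i = A $ i $ i * B $ i $ i"
    by simp
qed

lemma
  assumes "uptri A" "uptri B"
  shows uptri_mult: "uptri (A ** B)"
    and uptri_mult_diag: "(A ** B) $ i $ i = A $ i $ i * B $ i $ i"
proof -
  have "lowtri (transpose B)" "lowtri (transpose A)"
    using assms by (simp_all add: lowtri_transpose)
  from lowtri_mult[OF this] lowtri_mult_diag[OF this, of i]
  have "lowtri (transpose (A ** B))"
    "transpose (A ** B) $ i $ i = transpose B $ i $ i * transpose A $ i $ i"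
    by (simp_all only: matrix_transpose_mul)
  then show "uptri (A ** B)" "(A ** B) $ i $ i = A $ i $ i * B $ i $ i"
    by (simp_all add: lowtri_transpose) (simp add: transpose_def)
qed

text \<open>In the Leibniz sum a permutation contributes only if \<open>p i\<close> never exceeds
  \<open>i\<close>. By induction along the order and injectivity, such a permutation is the
  identity.\<close>

lemma det_lowtri:
  fixes A :: "'n::{finite,linorder} cmat"
  assumes "lowtri A"
  shows "det A = (\<Prod>i\<in>UNIV. A $ i $ i)"
proof -
  have id: "p = id" if p: "p permutes UNIV" and le: "\<And>i. p i \<le> i" for p :: "'n \<Rightarrow> 'n"
  proof
    fix i
    show "p i = id i"
    proof (induction i rule: finite_linorder_induct)
      case (1 i)
      then show ?case
        using le[of i] permutes_inj[OF p] by (metis id_apply injD order_less_le)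
    qed
  qed
  have zero: "of_int (sign p) * (\<Prod>i\<in>UNIV. A $ i $ p i) = 0"
    if p: "p \<in> {p. p permutes UNIV} - {id}" for p
  proof -
    obtain i where "i < p i"
      using id[of p] p by (force simp: not_le)
    then have "A $ i $ p i = 0"
      using assms by (simp add: lowtri_def)
    then show ?thesis
      by (auto intro!: prod_zero)
  qed
  have "det A = (\<Sum>p\<in>{id}. of_int (sign p) * (\<Prod>i\<in>UNIV. A $ i $ p i))"
    unfolding det_def
    by (rule sum.mono_neutral_right) (use zero in \<open>auto simp: permutes_id\<close>)
  then show ?thesis
    by (simp add: sign_id)
qed

lemma det_uptri:
  fixes A :: "'n::{finite,linorder} cmat"
  assumes "uptri A"
  shows "det A = (\<Prod>i\<in>UNIV. A $ i $ i)"
  using det_lowtri[of "transpose A"] assms by (simp add: lowtri_transpose) (simp add: transpose_def)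

text \<open>Forward substitution. In row \<open>i\<close> and column \<open>j > i\<close> of
  \<open>A ** matrix_inv A = mat 1\<close>, triangularity of \<open>A\<close> and the vanishing
  already shown for earlier rows of the inverse leave a single term, with the nonzero factor
  \<open>A $ i $ i\<close>.\<close>

lemma
  fixes A :: "'n::{finite,linorder} cmat"
  assumes A: "lowtri A" and det: "det A \<noteq> 0"
  shows lowtri_matrix_inv: "lowtri (matrix_inv A)"
    and lowtri_matrix_inv_diag: "matrix_inv A $ i $ i = 1 / A $ i $ i"
proof -
  have nz: "A $ i $ i \<noteq> 0" for i
    using det by (auto simp: det_lowtri[OF A])
  let ?B = "matrix_inv A"
  have "\<forall>j. i < j \<longrightarrow> ?B $ i $ j = 0" for i
  proof (induction i rule: finite_linorder_induct)
    case (1 i)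
    show ?case
    proof (intro allI impI)
      fix j assume ij: "i < j"
      have "A $ i $ k * ?B $ k $ j = 0" if "k \<noteq> i" for k
        using 1 ij A that by (cases "k < i") (auto simp: lowtri_def)
      then have "(\<Sum>k\<in>UNIV. A $ i $ k * ?B $ k $ j) = (\<Sum>k\<in>UNIV. if k = i then A $ i $ i * ?B $ i $ j else 0)"
        by (intro sum.cong) auto
      moreover have "(A ** ?B) $ i $ j = 0"
        using ij by (simp add: matrix_inv_right[OF det] mat_def)
      ultimately show "?B $ i $ j = 0"
        using nz[of i] by (simp add: matrix_matrix_mult_def)
    qed
  qed
  then show B: "lowtri ?B"
    by (simp add: lowtri_def)
  show "?B $ i $ i = 1 / A $ i $ i"
    using lowtri_mult_diag[OF A B, of i] nz[of i]
    by (simp add: matrix_inv_right[OF det] mat_def field_simps)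
qed

lemma matrix_inv_transpose:
  fixes A :: "'n::finite cmat"
  assumes "det A \<noteq> 0"
  shows "matrix_inv (transpose A) = transpose (matrix_inv A)"
  by (rule matrix_inv_eqI) (simp add: matrix_inv_left assms flip: matrix_transpose_mul)

lemma
  fixes A :: "'n::{finite,linorder} cmat"
  assumes "uptri A" "det A \<noteq> 0"
  shows uptri_matrix_inv: "uptri (matrix_inv A)"
    and uptri_matrix_inv_diag: "matrix_inv A $ i $ i = 1 / A $ i $ i"
proof -
  have "lowtri (transpose A)" "det (transpose A) \<noteq> 0"
    using assms by (simp_all add: lowtri_transpose)
  from lowtri_matrix_inv[OF this] lowtri_matrix_inv_diag[OF this, of i]
  show "uptri (matrix_inv A)" "matrix_inv A $ i $ i = 1 / A $ i $ i"
    by (simp_all add: matrix_inv_transpose[OF assms(2)] lowtri_transpose) (simp add: transpose_def)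
qed

text \<open>The inverse of \<open>w\<close> is lower triangular, and being the adjoint it is also
  upper triangular. Hence \<open>w\<close> is diagonal, with entries that are both positive and of
  modulus one.\<close>

lemma lowtri_unitary_posdiag:
  assumes low: "lowtri w" and "posdiag w" and uni: "adj w ** w = mat 1"
  shows "w = mat 1"
proof -
  have det: "det w \<noteq> 0"
    using arg_cong[OF uni, of det] by (auto simp: det_mul)
  have inv: "matrix_inv w = adj w"
    using uni matrix_left_right_inverse by (blast intro: matrix_inv_eqI)
  have "uptri (adj w)" "lowtri (adj w)"
    using lowtri_matrix_inv[OF low det] low by (simp_all add: inv uptri_adj)
  then have "w = diagm (\<lambda>i. w $ i $ i)"
    using low lowtri_adj lowtri_uptri_eq_diagm by blast
  moreover have "w $ i $ i = 1" for i
  proof -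
    have "cnj (w $ i $ i) * w $ i $ i = 1"
      using lowtri_mult_diag[OF \<open>lowtri (adj w)\<close> low, of i] unfolding uni
      by (simp add: adj_def mat_def)
    moreover have "w $ i $ i = of_real (Re (w $ i $ i))" "Re (w $ i $ i) > 0"
      using \<open>posdiag w\<close> by (simp_all add: posdiag_def complex_eq_iff)
    ultimately have "Re (w $ i $ i) * Re (w $ i $ i) = 1"
      by (metis complex_cnj_complex_of_real of_real_1 of_real_eq_iff of_real_mult)
    then have "Re (w $ i $ i) = 1"
      using \<open>Re (w $ i $ i) > 0\<close> by (auto simp: square_eq_1_iff)
    then show ?thesis
      using \<open>w $ i $ i = of_real (Re (w $ i $ i))\<close> by simp
  qed
  ultimately show ?thesis
    by (simp add: diagm_one)
qed

section \<open>Uniqueness of Cholesky factorizations\<close>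

lemma posdiag_nz: "posdiag A \<Longrightarrow> A $ i $ i \<noteq> 0"
  unfolding posdiag_def by (metis order_less_irrefl zero_complex.simps(1))

lemma posdiagI: "(\<And>i. \<exists>r>0. A $ i $ i = complex_of_real r) \<Longrightarrow> posdiag A"
  unfolding posdiag_def by (metis Im_complex_of_real Re_complex_of_real)

lemma posdiagE:
  assumes "posdiag A"
  obtains r where "r > 0" "A $ i $ i = complex_of_real r"
  using assms by (metis posdiag_def complex_is_Real_iff Re_complex_of_real Reals_cases)

lemma posdiag_lowtri_quotient:
  fixes a b :: "'n::{finite,linorder} cmat"
  assumes "lowtri a" "lowtri b" "posdiag a" "posdiag b" "det a \<noteq> 0"
  shows "posdiag (b ** matrix_inv a)"
proof (rule posdiagI)
  fix i
  obtain r s where "r > 0" "a $ i $ i = complex_of_real r" "s > 0" "b $ i $ i = complex_of_real s"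
    using assms by (meson posdiagE)
  then show "\<exists>r>0. (b ** matrix_inv a) $ i $ i = complex_of_real r"
    using assms
    by (intro exI[of _ "s / r"]) (simp add: lowtri_mult_diag lowtri_matrix_inv lowtri_matrix_inv_diag)
qed

lemma gram_eq_imp_unitary_quotient:
  fixes a b :: "'n::finite cmat"
  assumes "adj a ** a = adj b ** b" "det a \<noteq> 0"
  shows "adj (b ** matrix_inv a) ** (b ** matrix_inv a) = mat 1"
proof -
  have "adj (b ** matrix_inv a) ** (b ** matrix_inv a)
      = adj (matrix_inv a) ** (adj b ** b) ** matrix_inv a"
    by (simp add: adj_mult matrix_mul_assoc)
  also have "\<dots> = adj (a ** matrix_inv a) ** (a ** matrix_inv a)"
    by (simp add: adj_mult matrix_mul_assoc flip: assms(1))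
  finally show ?thesis
    by (simp add: matrix_inv_right[OF assms(2)])
qed

text \<open>Equal Gram matrices make the quotient \<open>b ** matrix_inv a\<close> unitary; it is
  also lower triangular with positive diagonal, hence the identity.\<close>

lemma cholesky_unique_lower:
  fixes a b :: "'n::{finite,linorder} cmat"
  assumes "lowtri a" "lowtri b" "posdiag a" "posdiag b" "adj a ** a = adj b ** b"
  shows "a = b"
proof -
  have det: "det a \<noteq> 0"
    using assms by (simp add: det_lowtri posdiag_nz)
  have "b ** matrix_inv a = mat 1"
    by (rule lowtri_unitary_posdiag[OF lowtri_mult[OF assms(2) lowtri_matrix_inv[OF assms(1) det]]
          posdiag_lowtri_quotient[OF assms(1-4) det] gram_eq_imp_unitary_quotient[OF assms(5) det]])
  then show ?thesis
    by (metis det matrix_inv_cancel(4) matrix_mul_lid)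
qed

lemma cholesky_unique_upper:
  fixes a b :: "'n::{finite,linorder} cmat"
  assumes "uptri a" "uptri b" "posdiag a" "posdiag b" "adj a ** a = adj b ** b"
  shows "a = b"
proof -
  have det: "det a \<noteq> 0"
    using assms by (simp add: det_uptri posdiag_nz)
  let ?w = "b ** matrix_inv a"
  have uni: "adj ?w ** ?w = mat 1"
    using assms det by (intro gram_eq_imp_unitary_quotient)
  have pos: "posdiag ?w"
  proof (rule posdiagI)
    fix i
    obtain r s where "r > 0" "a $ i $ i = complex_of_real r" "s > 0" "b $ i $ i = complex_of_real s"
      using assms by (meson posdiagE)
    then show "\<exists>r>0. ?w $ i $ i = complex_of_real r"
      using assms det
      by (intro exI[of _ "s / r"]) (simp add: uptri_mult_diag uptri_matrix_inv uptri_matrix_inv_diag)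
  qed
  \<comment> \<open>The adjoint turns the upper triangular quotient into a lower triangular one, so
    the rigidity of lower triangular unitaries applies.\<close>
  have "adj ?w = mat 1"
  proof (rule lowtri_unitary_posdiag)
    show "lowtri (adj ?w)"
      unfolding lowtri_adj by (intro uptri_mult uptri_matrix_inv assms det)
    show "adj (adj ?w) ** adj ?w = mat 1"
      using uni matrix_left_right_inverse unfolding adj_adj by blast
  qed (simp add: posdiag_adj pos)
  then have "?w = mat 1"
    by (metis adj_adj adj_mat1)
  then show ?thesis
    by (metis det matrix_inv_cancel(4) matrix_mul_lid)
qed

section \<open>Iwasawa decomposition\<close>

lemma Lgrp_iff: "l \<in> Lgrp \<longleftrightarrow> lowtri l \<and> (\<forall>i. l $ i $ i = 1)"
  by (simp add: Lgrp_def lowtri_def)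

lemma Ugrp_iff: "u \<in> Ugrp \<longleftrightarrow> uptri u \<and> posdiag u \<and> det u = 1"
  by (simp add: Ugrp_def uptri_def posdiag_def)

lemma det_Lgrp: "l \<in> Lgrp \<Longrightarrow> det l = 1"
  by (simp add: Lgrp_iff det_lowtri)

lemma posdiag_Lgrp: "l \<in> Lgrp \<Longrightarrow> posdiag l"
  by (simp add: Lgrp_iff posdiag_def)

lemma Lgrp_mult: "a \<in> Lgrp \<Longrightarrow> b \<in> Lgrp \<Longrightarrow> a ** b \<in> Lgrp"
  by (simp add: Lgrp_iff lowtri_mult lowtri_mult_diag)

lemma Lgrp_matrix_inv: "a \<in> Lgrp \<Longrightarrow> matrix_inv a \<in> Lgrp"
  using det_Lgrp[of a] by (simp add: Lgrp_iff lowtri_matrix_inv lowtri_matrix_inv_diag)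

lemma SUnD:
  assumes "k \<in> SUn"
  shows "k ** adj k = mat 1" "adj k ** k = mat 1" "det k = 1" "matrix_inv k = adj k"
  using assms matrix_left_right_inverse by (auto simp: SUn_def intro: matrix_inv_eqI)

lemma gram_unitary_mult: "adj k ** k = mat 1 \<Longrightarrow> adj (k ** u) ** (k ** u) = adj u ** u"
proof -
  assume *: "adj k ** k = mat 1"
  have "adj (k ** u) ** (k ** u) = adj u ** (adj k ** k) ** u"
    by (simp add: adj_mult matrix_mul_assoc)
  with * show ?thesis
    by simp
qed

lemma iwasawa_unique:
  assumes "k \<in> SUn" "k' \<in> SUn" "u \<in> Ugrp" "u' \<in> Ugrp" "k ** u = k' ** u'"
  shows "k = k' \<and> u = u'"
proof -
  have "adj u ** u = adj (k ** u) ** (k ** u)"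
    by (rule gram_unitary_mult[OF SUnD(2)[OF assms(1)], symmetric])
  also have "\<dots> = adj u' ** u'"
    unfolding assms(5) by (rule gram_unitary_mult[OF SUnD(2)[OF assms(2)]])
  finally have "adj u ** u = adj u' ** u'" .
  then have "u = u'"
    using assms(3,4) cholesky_unique_upper by (auto simp: Ugrp_iff)
  moreover have "det u \<noteq> 0"
    using assms by (simp add: Ugrp_iff)
  ultimately show ?thesis
    using assms(5) matrix_inv_cancel(3) by metis
qed

lemma kappa_nu_eqI:
  assumes "k \<in> SUn" "u \<in> Ugrp" "g = k ** u"
  shows "kappa g = k" "nu g = u"
proof -
  have "(THE p. fst p \<in> SUn \<and> snd p \<in> Ugrp \<and> g = fst p ** snd p) = (k, u)"
    using assms iwasawa_unique by (intro the_equality) (auto simp: prod_eq_iff)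
  then show "kappa g = k" "nu g = u"
    by (simp_all add: kappa_def nu_def)
qed

text \<open>Only the determinant of the product has to be known: \<open>det u\<close> is some
  \<open>p > 0\<close>, so \<open>det k = 1 / p\<close>, and since \<open>det k\<close> has modulus
  one, \<open>p = 1\<close>.\<close>

lemma unitary_upper_det1:
  assumes "adj k ** k = mat 1" "uptri u" "posdiag u" "det (k ** u) = 1"
  shows "k \<in> SUn" "u \<in> Ugrp"
proof -
  have "\<exists>r. r > 0 \<and> u $ i $ i = complex_of_real r" for i
    using posdiagE[OF assms(3)] by blast
  then obtain r where r: "\<And>i. r i > 0" "\<And>i. u $ i $ i = complex_of_real (r i)"
    by metis
  define p where "p = (\<Prod>i\<in>UNIV. r i)"
  have "p > 0"
    using r by (simp add: p_def prod_pos)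
  have "det u = of_real p"
    by (simp add: det_uptri assms r p_def)
  have "cnj (det k) * det k = 1"
    using arg_cong[OF assms(1), of det] by (simp add: det_mul det_adj)
  moreover have k: "det k = of_real (1 / p)"
    using assms(4) \<open>det u = of_real p\<close> \<open>p > 0\<close> by (simp add: det_mul field_simps)
  ultimately have "complex_of_real (1 / p * (1 / p)) = of_real 1"
    by simp
  then have "1 / p * (1 / p) = 1"
    using of_real_eq_iff by blast
  then have "p * p = 1"
    by (simp add: divide_simps split: if_splits)
  then have "p = 1"
    using \<open>p > 0\<close> by (auto simp: square_eq_1_iff)
  then show "k \<in> SUn" "u \<in> Ugrp"
    using k \<open>det u = of_real p\<close> assms matrix_left_right_inverse by (auto simp: SUn_def Ugrp_iff)
qed

text \<open>One Gram-Schmidt step. The vector \<open>c\<close> holds the coefficients of the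
  projection of column \<open>j\<close> of \<open>g\<close> onto the span of the earlier columns, so
  the corrected column is orthogonal to that span.\<close>

lemma orthogonal_column_exists:
  fixes g :: "'n::{finite,linorder} cmat"
  shows "\<exists>c. (\<forall>i\<ge>j. c $ i = 0) \<and>
    (\<forall>b. (\<forall>i\<ge>j. b $ i = 0) \<longrightarrow>
      (\<Sum>i\<in>UNIV. cnj ((g *v b) $ i) * (g *v (axis j 1 - c)) $ i) = 0)"
proof -
  define V where "V = {g *v b | b. \<forall>i\<ge>j. b $ i = 0}"
  have lin: "g *v (r *\<^sub>R a) = r *\<^sub>R (g *v a)" for r a
    using linear_cmul matrix_vector_mul_linear by blast
  have "subspace V"
  proof (rule subspaceI)
    show "0 \<in> V"
      unfolding V_def by (intro CollectI exI[of _ 0]) simp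
    show "x + y \<in> V" if xy: "x \<in> V" "y \<in> V" for x y
    proof -
      obtain a b where "x = g *v a" "y = g *v b" "\<forall>i\<ge>j. a $ i = 0" "\<forall>i\<ge>j. b $ i = 0"
        using xy by (auto simp: V_def)
      then show ?thesis
        unfolding V_def by (intro CollectI exI[of _ "a + b"]) (simp add: algebra_simps)
    qed
    show "r *\<^sub>R x \<in> V" if x: "x \<in> V" for r x
    proof -
      obtain a where "x = g *v a" "\<forall>i\<ge>j. a $ i = 0"
        using x by (auto simp: V_def)
      then show ?thesis
        unfolding V_def by (intro CollectI exI[of _ "r *\<^sub>R a"]) (simp add: lin)
    qed
  qed
  then have span: "span V = V"
    by (simp add: span_eq_iff)
  obtain y z where yz: "y \<in> V" "\<And>w. w \<in> V \<Longrightarrow> orthogonal z w" "g *v axis j 1 = y + z"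
    using orthogonal_subspace_decomp_exists[of V "g *v axis j 1"] unfolding span by metis
  then obtain c where c: "\<forall>i\<ge>j. c $ i = 0" "y = g *v c"
    by (auto simp: V_def)
  have z: "z = g *v (axis j 1 - c)"
    using yz c by (simp add: matrix_vector_mult_diff_distrib)
  \<comment> \<open>The library projection is orthogonal for the real inner product; since \<open>V\<close> is closed under
    multiplication by \<open>\<i>\<close>, this is Hermitian orthogonality.\<close>
  have re: "Re (\<Sum>i\<in>UNIV. cnj (v $ i) * z $ i) = 0" if "v \<in> V" for v
    using yz(2)[OF that] by (simp add: orthogonal_def inner_vec_def inner_complex_def mult.commute)
  have "(\<Sum>i\<in>UNIV. cnj ((g *v b) $ i) * z $ i) = 0" if "\<forall>i\<ge>j. b $ i = 0" for b
  proof -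
    have "g *v b \<in> V"
      using that by (auto simp: V_def)
    moreover have ib: "g *v (\<i> *s b) = \<i> *s (g *v b)"
      by (simp add: vec_eq_iff matrix_vector_mult_def sum_distrib_left algebra_simps)
    have "\<i> *s (g *v b) \<in> V"
      unfolding V_def using that by (intro CollectI exI[of _ "\<i> *s b"]) (simp add: ib)
    from re[OF this] have "Im (\<Sum>i\<in>UNIV. cnj ((g *v b) $ i) * z $ i) = 0"
      by (simp add: algebra_simps sum_subtractf)
    ultimately show ?thesis
      using re by (simp add: complex_eq_iff)
  qed
  then show ?thesis
    using c(1) z by blast
qed

text \<open>Gram-Schmidt in matrix form. The corrections of all columns are collected in a unipotent
  upper triangular \<open>W\<close>; the columns of \<open>q = g ** W\<close> are pairwise
  orthogonal, and normalizing them yields the unitary factor.\<close>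

lemma iwasawa_exists:
  fixes g :: "'n::{finite,linorder} cmat"
  assumes det: "det g = 1"
  shows "\<exists>k u. k \<in> SUn \<and> u \<in> Ugrp \<and> g = k ** u"
proof -
  obtain c :: "'n \<Rightarrow> complex^('n::{finite,linorder})" where c: "\<And>i j. i \<ge> j \<Longrightarrow> c j $ i = 0"
    and orth: "\<And>j b. (\<And>i. i \<ge> j \<Longrightarrow> b $ i = 0) \<Longrightarrow>
      (\<Sum>i\<in>UNIV. cnj ((g *v b) $ i) * (g *v (axis j 1 - c j)) $ i) = 0"
    using orthogonal_column_exists[of _ g] by metis
  define w where "w j = axis j 1 - c j" for j
  define W where "W = (\<chi> i j. w j $ i)"
  have W: "uptri W" "\<And>i. W $ i $ i = 1"
    using c by (auto simp: uptri_def W_def w_def axis_def)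
  have detW: "det W = 1"
    by (simp add: det_uptri W)
  define q where "q = g ** W"
  have q: "q $ i $ j = (g *v w j) $ i" for i j
    by (simp add: q_def W_def matrix_matrix_mult_def matrix_vector_mult_def)
  have gram: "(adj q ** q) $ i $ j = (\<Sum>k\<in>UNIV. cnj (q $ k $ i) * q $ k $ j)" for i j
    by (simp add: matrix_matrix_mult_def adj_def)
  \<comment> \<open>For \<open>i < j\<close> the vector \<open>w i\<close> is supported on indices
    below \<open>j\<close>, so it is an admissible test vector in \<open>orth\<close>.\<close>
  have upper: "(adj q ** q) $ i $ j = 0" if "i < j" for i j
    unfolding gram q w_def[of j] using that c
    by (intro orth) (auto simp: w_def axis_def)
  have herm: "(adj q ** q) $ j $ i = cnj ((adj q ** q) $ i $ j)" for i j
    unfolding gram by (simp add: mult.commute)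
  define d where "d j = (\<Sum>k\<in>UNIV. (cmod (q $ k $ j))\<^sup>2)" for j
  have diag: "(adj q ** q) $ j $ j = complex_of_real (d j)" for j
    unfolding gram d_def by (simp add: complex_norm_square mult.commute del: of_real_power)
  have "(adj q ** q) $ i $ j = diagm (\<lambda>j. complex_of_real (d j)) $ i $ j" for i j
    using upper[of i j] upper[of j i] herm[of i j] diag[of i]
    by (cases i j rule: linorder_cases) (auto simp: diagm_nth)
  then have gramd: "adj q ** q = diagm (\<lambda>j. complex_of_real (d j))"
    by (simp add: vec_eq_iff)
  \<comment> \<open>Nonsingularity of \<open>g\<close> excludes zero columns, so the squared column
    norms \<open>d j\<close> are strictly positive.\<close>
  have "det (adj q ** q) \<noteq> 0"
    by (simp add: det_mul det_adj q_def detW det)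
  then have "d j \<noteq> 0" for j
    by (simp add: gramd det_diagm)
  moreover have "d j \<ge> 0" for j
    by (simp add: d_def sum_nonneg)
  ultimately have d: "d j > 0" for j
    using less_eq_real_def by metis
  \<comment> \<open>\<open>S\<close> normalizes the columns of \<open>q\<close>. Its inverse
    \<open>T\<close> is absorbed into the upper triangular factor, where its positive entries become
    the diagonal.\<close>
  define S where "S = diagm (\<lambda>j. complex_of_real (1 / sqrt (d j)))"
  define T where "T = diagm (\<lambda>j. complex_of_real (sqrt (d j)))"
  have ST: "S ** T = mat 1"
    using d by (simp add: S_def T_def diagm_mult less_imp_neq[THEN not_sym] flip: diagm_one of_real_mult)
  have "adj (q ** S) ** (q ** S) = adj S ** (adj q ** q) ** S"
    by (simp add: adj_mult matrix_mul_assoc)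
  also have "\<dots> = mat 1"
  proof -
    have "1 / sqrt (d j) * d j * (1 / sqrt (d j)) = 1" for j
      using d[of j] by (simp add: field_simps)
    then have "complex_of_real (1 / sqrt (d j)) * complex_of_real (d j) * complex_of_real (1 / sqrt (d j)) = 1" for j
      by (metis of_real_1 of_real_mult)
    then show ?thesis
      by (simp add: gramd S_def adj_diagm diagm_mult diagm_one)
  qed
  finally have k: "adj (q ** S) ** (q ** S) = mat 1" .
  have u: "uptri (T ** matrix_inv W)"
    using W detW by (simp add: T_def uptri_mult uptri_matrix_inv)
  have pos: "posdiag (T ** matrix_inv W)"
    using d W detW by (simp add: posdiag_def T_def uptri_matrix_inv_diag)
  have g: "g = (q ** S) ** (T ** matrix_inv W)"
  proof -
    have "(q ** S) ** (T ** matrix_inv W) = q ** (S ** T) ** matrix_inv W"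
      by (simp add: matrix_mul_assoc)
    then show ?thesis
      using detW by (simp add: ST q_def matrix_inv_cancel)
  qed
  then show ?thesis
    using unitary_upper_det1[OF k u pos] det by metis
qed

lemma Lgrp_iwasawa:
  assumes "m \<in> Lgrp"
  shows "kappa m \<in> SUn" "nu m \<in> Ugrp" "m = kappa m ** nu m"
proof -
  obtain k u where "k \<in> SUn" "u \<in> Ugrp" "m = k ** u"
    using iwasawa_exists det_Lgrp[OF assms] by blast
  then show "kappa m \<in> SUn" "nu m \<in> Ugrp" "m = kappa m ** nu m"
    using kappa_nu_eqI by metis+
qed

section \<open>The (Y, Z) variables\<close>

lemma conjm_matrix_inv: "det g \<noteq> 0 \<Longrightarrow> conjm (matrix_inv g) X = matrix_inv g ** X ** g"
  by (simp add: conjm_def matrix_inv_inv)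

text \<open>Two conjugators of \<open>diagm lam\<close> with the same result differ by a matrix
  \<open>A\<close> in its centralizer, which is diagonal. Comparing Iwasawa factors shows that
  \<open>A\<close> is positive, comparing Gram matrices gives \<open>m = m' ** A\<close>, and the
  unit diagonals then force \<open>A = mat 1\<close>.\<close>

lemma flag_decomposition_unique:
  fixes l m :: "'n::{finite,linorder} cmat"
  assumes inj: "inj lam"
    and L: "l \<in> Lgrp" "l' \<in> Lgrp" "m \<in> Lgrp" "m' \<in> Lgrp"
    and K: "k \<in> SUn" "k' \<in> SUn" and U: "u \<in> Ugrp" "u' \<in> Ugrp"
    and m: "m = k ** u" and m': "m' = k' ** u'"
    and eq: "conjm (matrix_inv (l ** k)) (diagm lam) = conjm (matrix_inv (l' ** k')) (diagm lam)"
  shows "l = l'" "m = m'"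
proof -
  define g where "g = l ** k"
  define g' where "g' = l' ** k'"
  have det: "det g \<noteq> 0" "det g' \<noteq> 0" "det u \<noteq> 0" "det u' \<noteq> 0" "det (l' ** m') \<noteq> 0"
    using L K U by (simp_all add: g_def g'_def det_mul det_Lgrp SUnD Ugrp_iff)
  define A where "A = g' ** matrix_inv g"
  have "A ** diagm lam = g' ** (matrix_inv g ** diagm lam ** g) ** matrix_inv g"
    unfolding A_def matrix_mul_assoc by (simp add: matrix_inv_cancel det)
  also have "\<dots> = g' ** (matrix_inv g' ** diagm lam ** g') ** matrix_inv g"
    using eq det(1,2) by (simp add: conjm_matrix_inv flip: g_def g'_def)
  also have "\<dots> = diagm lam ** A"
    unfolding A_def matrix_mul_assoc by (simp add: matrix_inv_right det)
  finally have A: "A = diagm (\<lambda>i. A $ i $ i)"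
    by (rule commutes_diagm_imp_diagonal[OF inj])
  then have tri: "lowtri A" "uptri A"
    using lowtri_diagm uptri_diagm by metis+
  have g': "g' = A ** g"
    unfolding A_def by (simp add: matrix_inv_cancel det)
  have k: "k = m ** matrix_inv u" and k': "k' = m' ** matrix_inv u'"
    unfolding m m' by (simp_all add: matrix_inv_cancel det)
  \<comment> \<open>\<open>B\<close> is lower triangular by this definition and upper triangular as
    \<open>matrix_inv u' ** u\<close>, hence diagonal. The unipotent factors do not change the
    diagonal of \<open>A\<close>, so \<open>B = A\<close>.\<close>
  define B where "B = matrix_inv (l' ** m') ** (A ** (l ** m))"
  have "l' ** m' ** matrix_inv u' = A ** (l ** m) ** matrix_inv u"
    using g' unfolding g_def g'_def k k' by (simp add: matrix_mul_assoc)
  then have "B = matrix_inv (l' ** m') ** (l' ** m' ** matrix_inv u' ** u)"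
    unfolding B_def by (simp add: matrix_inv_cancel det)
  also have "\<dots> = matrix_inv u' ** u"
    unfolding matrix_mul_assoc[of "l' ** m'", symmetric] by (simp add: matrix_inv_cancel det)
  finally have B: "B = matrix_inv u' ** u" .
  have "uptri B"
    unfolding B using U det by (simp add: uptri_mult uptri_matrix_inv Ugrp_iff)
  have lowlm: "lowtri (l ** m)" "(l ** m) $ i $ i = 1"
    "lowtri (matrix_inv (l' ** m'))" "matrix_inv (l' ** m') $ i $ i = 1" for i
    using Lgrp_mult Lgrp_matrix_inv L by (metis Lgrp_iff)+
  have "lowtri B"
    unfolding B_def by (intro lowtri_mult lowlm tri)
  have "B $ i $ i = A $ i $ i" for i
    unfolding B_def by (simp add: lowtri_mult_diag lowtri_mult lowlm tri)
  then have BA: "B = A"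
    using A lowtri_uptri_eq_diagm[OF \<open>lowtri B\<close> \<open>uptri B\<close>] by simp
  have u: "u = u' ** A"
    unfolding BA[symmetric] B by (simp add: matrix_inv_cancel det)
  have "posdiag A"
  proof (rule posdiagI)
    fix i
    obtain r s where "r > 0" "u $ i $ i = complex_of_real r" "s > 0" "u' $ i $ i = complex_of_real s"
      using U by (metis Ugrp_iff posdiagE)
    moreover have "u $ i $ i = u' $ i $ i * A $ i $ i"
      unfolding u using U tri by (simp add: uptri_mult_diag Ugrp_iff)
    ultimately show "\<exists>r>0. A $ i $ i = complex_of_real r"
      by (intro exI[of _ "r / s"]) (simp add: field_simps)
  qed
  have "posdiag (m' ** A)"
    using \<open>posdiag A\<close> L tri by (simp add: posdiag_def lowtri_mult_diag Lgrp_iff)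
  \<comment> \<open>Unitary factors on the left do not affect Gram matrices, so \<open>m\<close> and
    \<open>m' ** A\<close> have the same one, namely that of \<open>u\<close>.\<close>
  have "adj m ** m = adj u ** u"
    unfolding m by (rule gram_unitary_mult[OF SUnD(2)[OF K(1)]])
  also have "\<dots> = adj (k' ** u) ** (k' ** u)"
    by (rule gram_unitary_mult[OF SUnD(2)[OF K(2)], symmetric])
  also have "k' ** u = m' ** A"
    unfolding m' u by (simp add: matrix_mul_assoc)
  finally have mA: "m = m' ** A"
    using cholesky_unique_lower[of m "m' ** A"] \<open>posdiag (m' ** A)\<close> L tri
    by (simp add: Lgrp_iff lowtri_mult posdiag_Lgrp)
  have "A $ i $ i = 1" for i
    using lowtri_mult_diag[of m' A i] L tri unfolding mA[symmetric] by (simp add: Lgrp_iff)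
  then have A1: "A = mat 1"
    using A by (simp add: diagm_one)
  then show "m = m'"
    using mA by simp
  have "u = u'" "g' = g"
    using u g' A1 by simp_all
  then show "l = l'"
    using \<open>m = m'\<close> unfolding g_def g'_def k k'
    by (metis L(3) SUnD(3) K(1) det(3) k matrix_inv_cancel(3) one_neq_zero)
qed

text \<open>Since \<open>m = kappa m ** nu m\<close>, the inverse of \<open>l ** kappa m\<close>
  equals \<open>nu m ** matrix_inv (l ** m)\<close>. Thus the second unipotent factor is
  \<open>l ** m\<close>, and the pair \<open>(l, m)\<close> encodes both presentations of
  \<open>X\<close>.\<close>

lemma phiYZ_eq:
  fixes l m :: "'n::{finite,linorder} cmat"
  assumes inj: "inj lam" and l: "l \<in> Lgrp" and m: "m \<in> Lgrp"
    and X: "X = conjm (matrix_inv (l ** kappa m)) (diagm lam)"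
  shows "phiYZ (diagm lam) X =
    (conjm (matrix_inv l) (diagm lam), conjm (matrix_inv (l ** m)) (diagm lam))"
proof -
  have inv: "nu b ** matrix_inv (a ** b) = matrix_inv (a ** kappa b)"
    if "a \<in> Lgrp" "b \<in> Lgrp" for a b :: "'n cmat"
  proof (rule matrix_inv_eqI[symmetric])
    have "(a ** kappa b) ** (nu b ** matrix_inv (a ** b))
        = a ** (kappa b ** nu b) ** matrix_inv (a ** b)"
      by (simp add: matrix_mul_assoc)
    also have "\<dots> = mat 1"
      using that by (simp add: matrix_inv_right det_mul det_Lgrp flip: Lgrp_iwasawa(3))
    finally show "(a ** kappa b) ** (nu b ** matrix_inv (a ** b)) = mat 1" .
  qed
  have uniq: "a = l \<and> b = m"
    if "a \<in> Lgrp" "b \<in> Lgrp" "X = conjm (matrix_inv (a ** kappa b)) (diagm lam)" for a b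
    using flag_decomposition_unique[OF inj that(1) l that(2) m _ _ _ _ Lgrp_iwasawa(3) Lgrp_iwasawa(3)]
      that X l m by (simp add: Lgrp_iwasawa)
  show ?thesis
    unfolding phiYZ_def
  proof (rule the_equality)
    show "\<exists>k u l1 l2. k \<in> Cset \<and> u \<in> Dset \<and> l1 \<in> Lgrp \<and> l2 \<in> Lgrp \<and>
      X = conjm (matrix_inv (l1 ** k)) (diagm lam) \<and> X = conjm (u ** matrix_inv l2) (diagm lam) \<and>
      (conjm (matrix_inv l) (diagm lam), conjm (matrix_inv (l ** m)) (diagm lam)) =
      (conjm (matrix_inv l1) (diagm lam), conjm (matrix_inv l2) (diagm lam))"
      using l m X by (intro exI[of _ "kappa m"] exI[of _ "nu m"] exI[of _ l] exI[of _ "l ** m"])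
        (simp add: Cset_def Dset_def Lgrp_mult inv)
  next
    fix p
    assume "\<exists>k u l1 l2. k \<in> Cset \<and> u \<in> Dset \<and> l1 \<in> Lgrp \<and> l2 \<in> Lgrp \<and>
      X = conjm (matrix_inv (l1 ** k)) (diagm lam) \<and> X = conjm (u ** matrix_inv l2) (diagm lam) \<and>
      p = (conjm (matrix_inv l1) (diagm lam), conjm (matrix_inv l2) (diagm lam))"
    then obtain m1 m2 l1 l2 where *: "m1 \<in> Lgrp" "m2 \<in> Lgrp" "l1 \<in> Lgrp" "l2 \<in> Lgrp"
      "X = conjm (matrix_inv (l1 ** kappa m1)) (diagm lam)"
      "X = conjm (nu m2 ** matrix_inv l2) (diagm lam)"
      "p = (conjm (matrix_inv l1) (diagm lam), conjm (matrix_inv l2) (diagm lam))"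
      unfolding Cset_def Dset_def by blast
    have "l1 = l"
      using uniq * by blast
    \<comment> \<open>Splitting off \<open>m2\<close> rewrites the second presentation in the form
      of the first, so the same uniqueness statement identifies \<open>l2\<close>.\<close>
    have l2: "l2 = (l2 ** matrix_inv m2) ** m2"
      using *(2) by (simp add: matrix_inv_cancel det_Lgrp)
    have L: "l2 ** matrix_inv m2 \<in> Lgrp"
      using * by (simp add: Lgrp_mult Lgrp_matrix_inv)
    have "X = conjm (matrix_inv (l2 ** matrix_inv m2 ** kappa m2)) (diagm lam)"
      using *(6) inv[OF L *(2)] l2 by simp
    then have "l2 ** matrix_inv m2 = l" "m2 = m"
      using uniq[OF L *(2)] by auto
    then show "p = (conjm (matrix_inv l) (diagm lam), conjm (matrix_inv (l ** m)) (diagm lam))"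
      using * l2 \<open>l1 = l\<close> by simp
  qed
qed

section \<open>Linear differential equations\<close>

lemma zero_vector_derivative_const:
  fixes f :: "real \<Rightarrow> 'a::real_normed_vector"
  assumes "\<And>x. x \<in> {p..q} \<Longrightarrow> (f has_vector_derivative 0) (at x within {p..q})"
    and "x \<in> {p..q}" "y \<in> {p..q}"
  shows "f x = f y"
proof -
  have "closed_segment y x \<subseteq> {p..q}"
    using assms by (simp add: closed_segment_subset)
  then show ?thesis
    using vector_differentiable_bound_linearization[of "{p..q}" f "\<lambda>_. 0" y x y 0] assms by simp
qed

text \<open>A local Gronwall argument: on a short interval around the zero \<open>c\<close>, the
  maximum of \<open>norm (f s)\<close> is bounded by half of itself.\<close>

lemma linear_bound_solution_zero:
  fixes f :: "real \<Rightarrow> 'a::real_normed_vector"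
  assumes c: "p < c" "c < q"
    and f: "\<And>s. s \<in> {p..q} \<Longrightarrow> (f has_vector_derivative f' s) (at s within {p..q})"
    and bound: "\<And>s. s \<in> {p..q} \<Longrightarrow> norm (f' s) \<le> K * norm (f s)"
    and "f c = 0"
  shows "\<forall>\<^sub>F s in nhds c. f s = 0"
proof -
  \<comment> \<open>The radius keeps the interval inside \<open>{p..q}\<close> and gives
    \<open>\<bar>K\<bar> * d \<le> 1 / 2\<close>; the summand \<open>1\<close> avoids division by
    zero.\<close>
  define d where "d = Min {c - p, q - c, 1 / (2 * (\<bar>K\<bar> + 1))}"
  have d: "d > 0" "d \<le> c - p" "d \<le> q - c" "d \<le> 1 / (2 * (\<bar>K\<bar> + 1))"
    using c by (simp_all add: d_def add_nonneg_pos)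
  then have "\<bar>K\<bar> * d \<le> 1 / 2"
    using mult_left_mono[of d "1 / (2 * (\<bar>K\<bar> + 1))" "\<bar>K\<bar>"]
    by (simp add: field_simps)
  let ?I = "{c - d..c + d}"
  have sub: "?I \<subseteq> {p..q}"
    using d by auto
  have f_I: "(f has_vector_derivative f' s) (at s within ?I)" if "s \<in> ?I" for s
    using f sub that has_vector_derivative_within_subset by blast
  have "continuous_on ?I (\<lambda>s. norm (f s))"
    by (intro continuous_on_norm continuous_on_vector_derivative[of _ f f'] f_I)
  then obtain y where y: "y \<in> ?I" "\<And>s. s \<in> ?I \<Longrightarrow> norm (f s) \<le> norm (f y)"
    using continuous_attains_sup[of ?I "\<lambda>s. norm (f s)"] d by auto
  have "f' c = 0"
    using bound[of c] c \<open>f c = 0\<close> by simp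
  have "norm (f y - f c - (y - c) *\<^sub>R f' c) \<le> norm (y - c) * (\<bar>K\<bar> * norm (f y))"
  proof (rule vector_differentiable_bound_linearization[OF f_I])
    show "closed_segment c y \<subseteq> ?I"
      using d y by (intro closed_segment_subset) auto
    fix s assume s: "s \<in> ?I"
    have "norm (f' s) \<le> K * norm (f s)"
      using bound s sub by blast
    also have "\<dots> \<le> \<bar>K\<bar> * norm (f y)"
      using y(2)[OF s] by (intro mult_mono) auto
    finally show "norm (f' s - f' c) \<le> \<bar>K\<bar> * norm (f y)"
      by (simp add: \<open>f' c = 0\<close>)
  qed (use d in auto)
  then have "norm (f y) \<le> \<bar>y - c\<bar> * \<bar>K\<bar> * norm (f y)"
    by (simp add: \<open>f c = 0\<close> \<open>f' c = 0\<close> mult.assoc)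
  also have "\<dots> \<le> d * \<bar>K\<bar> * norm (f y)"
    using y(1) by (intro mult_right_mono) auto
  also have "\<dots> \<le> 1 / 2 * norm (f y)"
    using \<open>\<bar>K\<bar> * d \<le> 1 / 2\<close> by (intro mult_right_mono) (auto simp: mult.commute)
  finally have "norm (f y) = 0"
    using norm_ge_zero[of "f y"] by linarith
  then have "f s = 0" if "s \<in> ?I" for s
    using y(2)[OF that] by simp
  moreover have "\<forall>\<^sub>F s in nhds c. s \<in> {c - d<..<c + d}"
    using d by (intro eventually_nhds_in_open) auto
  ultimately show ?thesis
    by (auto elim!: eventually_mono)
qed

text \<open>Picard iteration as a contraction on bounded continuous functions. The integral starts
  at the left end \<open>p\<close>, so the solution is normalized there; moving the base point to an
  interior time is left to the application.\<close>

lemma linear_matrix_ode_exists: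
  fixes A :: "real \<Rightarrow> 'n::finite cmat"
  assumes c: "a < c" "c < b" and A: "continuous_on {a..b} A"
  obtains p q Q where "a \<le> p" "p < c" "c < q" "q \<le> b" "Q p = mat 1"
    "\<And>s. s \<in> {p..q} \<Longrightarrow> (Q has_vector_derivative Q s ** A s) (at s within {p..q})"
proof -
  obtain K where K: "K > 0" "\<And>(x :: 'n cmat) (y :: 'n cmat). norm (x ** y) \<le> norm x * norm y * K"
    using bounded_bilinear.pos_bounded[OF bounded_bilinear_matrix_mult[where 'n = 'n]] by auto
  have "bounded (A ` {a..b})"
    using A by (intro compact_imp_bounded compact_continuous_image) auto
  then obtain M where M: "M > 0" "\<And>s. s \<in> {a..b} \<Longrightarrow> norm (A s) \<le> M"
    by (auto simp: bounded_pos)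
  \<comment> \<open>The interval has length \<open>2 * d\<close>, so the bound
    \<open>1 / (4 * M * K)\<close> yields the contraction constant \<open>1 / 2\<close>.\<close>
  define d where "d = Min {c - a, b - c, 1 / (4 * M * K)}"
  have d: "d > 0" "d \<le> c - a" "d \<le> b - c" "d \<le> 1 / (4 * M * K)"
    using c K M by (simp_all add: d_def)
  then have MKd: "M * K * (2 * d) \<le> 1 / 2"
    using K M by (simp add: field_simps)
  define p where "p = c - d"
  define q where "q = c + d"
  have pq: "a \<le> p" "p < c" "c < q" "q \<le> b" "p \<le> q" "q - p = 2 * d"
    using d by (auto simp: p_def q_def)
  have A_pq: "continuous_on {p..q} A"
    using A by (rule continuous_on_subset) (use pq in auto)
  \<comment> \<open>Clamping time to \<open>{p..q}\<close> extends the integral operator to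
    functions on the whole line, as the type of bounded continuous functions requires; inside the
    interval \<open>cl\<close> is the identity.\<close>
  define cl where "cl s = max p (min q s)" for s
  have cl: "cl s \<in> {p..q}" for s
    using pq by (auto simp: cl_def)
  have cont: "continuous_on {p..q} (\<lambda>r. f r ** A r)" if "continuous_on {p..q} f" for f :: "real \<Rightarrow> 'n cmat"
    by (intro bounded_bilinear.continuous_on[OF bounded_bilinear_matrix_mult] that A_pq)
  define T where "T f s = mat 1 + integral {p..cl s} (\<lambda>r. apply_bcontfun f r ** A r)"
    for f :: "real \<Rightarrow>\<^sub>C 'n cmat" and s
  have T: "T f \<in> bcontfun" for f
  proof -
    have c1: "continuous_on {p..q} (\<lambda>s. integral {p..s} (\<lambda>r. apply_bcontfun f r ** A r))"
      by (intro indefinite_integral_continuous_1 integrable_continuous_real cont) simp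
    have "continuous_on UNIV cl"
      unfolding cl_def by (intro continuous_intros)
    moreover have "cl ` UNIV \<subseteq> {p..q}"
      using cl by blast
    ultimately have "continuous_on UNIV (\<lambda>s. integral {p..cl s} (\<lambda>r. apply_bcontfun f r ** A r))"
      by (rule continuous_on_compose2[OF c1])
    then have "continuous_on UNIV (T f)"
      unfolding T_def by (intro continuous_intros)
    moreover have "bounded ((\<lambda>s. mat 1 + integral {p..s} (\<lambda>r. apply_bcontfun f r ** A r)) ` {p..q})"
      by (intro compact_imp_bounded compact_continuous_image continuous_intros c1) auto
    then have "bounded (range (T f))"
      by (rule bounded_subset) (use cl in \<open>auto simp: T_def\<close>)
    ultimately show ?thesis
      by (simp add: bcontfun_def)
  qed
  have contraction: "dist (Bcontfun (T f)) (Bcontfun (T g)) \<le> 1 / 2 * dist f g" for f g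
  proof (rule dist_bound)
    fix s
    have "T f s - T g s = integral {p..cl s} (\<lambda>r. apply_bcontfun f r ** A r)
        - integral {p..cl s} (\<lambda>r. apply_bcontfun g r ** A r)"
      by (simp add: T_def)
    also have "\<dots> = integral {p..cl s} (\<lambda>r. apply_bcontfun f r ** A r - apply_bcontfun g r ** A r)"
      using cl[of s]
      by (intro integral_diff[symmetric] integrable_continuous_real)
        (auto intro!: continuous_on_subset[OF cont[OF continuous_on_apply_bcontfun]])
    finally have eq: "T f s - T g s =
        integral {p..cl s} (\<lambda>r. (apply_bcontfun f r - apply_bcontfun g r) ** A r)"
      by (simp add: matrix_diff_distribs)
    have "norm (T f s - T g s) \<le> (dist f g * M * K) * (cl s - p)"
      unfolding eq
    proof (rule integral_bound)
      show "p \<le> cl s"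
        using cl[of s] by simp
      have "continuous_on {p..q} (\<lambda>r. (apply_bcontfun f r - apply_bcontfun g r) ** A r)"
        by (intro cont continuous_on_diff continuous_on_apply_bcontfun)
      then show "continuous_on {p..cl s} (\<lambda>r. (apply_bcontfun f r - apply_bcontfun g r) ** A r)"
        by (rule continuous_on_subset) (use cl[of s] in auto)
      fix r assume "r \<in> {p..cl s}"
      then have "r \<in> {a..b}"
        using cl[of s] pq by auto
      have "norm ((apply_bcontfun f r - apply_bcontfun g r) ** A r)
          \<le> norm (apply_bcontfun f r - apply_bcontfun g r) * norm (A r) * K"
        by (rule K)
      also have "\<dots> \<le> dist f g * M * K"
        using K M(2)[OF \<open>r \<in> {a..b}\<close>] dist_bounded[of f r g]
        by (intro mult_right_mono mult_mono) (auto simp: dist_norm)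
      finally show "norm ((apply_bcontfun f r - apply_bcontfun g r) ** A r) \<le> dist f g * M * K" .
    qed
    also have "\<dots> \<le> (dist f g * M * K) * (2 * d)"
      using cl[of s] pq K M by (intro mult_left_mono) auto
    also have "\<dots> \<le> 1 / 2 * dist f g"
      using mult_left_mono[OF MKd, of "dist f g"] by (simp add: algebra_simps)
    finally show "dist (apply_bcontfun (Bcontfun (T f)) s) (apply_bcontfun (Bcontfun (T g)) s) \<le> 1 / 2 * dist f g"
      by (simp add: Bcontfun_inverse[OF T] dist_norm)
  qed
  have "\<exists>!f. Bcontfun (T f) = f"
    by (rule banach_fix_type[of "1 / 2"]) (use contraction in simp_all)
  then obtain F where "Bcontfun (T F) = F"
    by blast
  then have F: "apply_bcontfun F = T F"
    by (metis Bcontfun_inverse T)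
  show thesis
  proof (rule that[of p q "apply_bcontfun F"])
    show "apply_bcontfun F p = mat 1"
      using pq unfolding F by (simp add: T_def cl_def)
    fix s assume s: "s \<in> {p..q}"
    have "((\<lambda>s. integral {p..s} (\<lambda>r. apply_bcontfun F r ** A r)) has_vector_derivative
        apply_bcontfun F s ** A s) (at s within {p..q})"
      by (intro integral_has_vector_derivative cont s) simp
    then have "((\<lambda>s. mat 1 + integral {p..s} (\<lambda>r. apply_bcontfun F r ** A r)) has_vector_derivative
        apply_bcontfun F s ** A s) (at s within {p..q})"
      by (auto intro!: derivative_eq_intros)
    then show "(apply_bcontfun F has_vector_derivative apply_bcontfun F s ** A s) (at s within {p..q})"
    proof (rule has_vector_derivative_transform[OF s, rotated])
      fix r assume "r \<in> {p..q}"
      then have "cl r = r"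
        by (simp add: cl_def)
      then show "apply_bcontfun F r = mat 1 + integral {p..r} (\<lambda>r. apply_bcontfun F r ** A r)"
        by (subst F) (simp add: T_def)
    qed
  qed (use pq in auto)
qed

section \<open>Local factorization of Toda trajectories\<close>

lemma bounded_linear_adj: "bounded_linear (adj :: 'n::finite cmat \<Rightarrow> 'n cmat)"
  unfolding linear_conv_bounded_linear[symmetric] linear_iff
  by (simp add: adj_def vec_eq_iff)

lemmas has_vector_derivative_adj = bounded_linear.has_vector_derivative[OF bounded_linear_adj]

lemma has_vector_derivative_vecI:
  fixes f :: "real \<Rightarrow> 'a::real_normed_vector^'n"
  assumes "\<And>i. ((\<lambda>t. f t $ i) has_vector_derivative f' $ i) (at x within S)"
  shows "(f has_vector_derivative f') (at x within S)"
  using assms unfolding has_vector_derivative_def has_derivative_def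
  by (auto intro!: vec_tendstoI bounded_linear_scaleR_left)

text \<open>This is the matrix exponential of \<open>t\<close> times \<open>diagm d\<close>, which
  for a diagonal matrix reduces to scalar exponentials.\<close>

definition dexp :: "('n::finite \<Rightarrow> complex) \<Rightarrow> real \<Rightarrow> 'n cmat" where
  "dexp d t = diagm (\<lambda>i. exp (of_real t * d i))"

lemma has_vector_derivative_exp_linear:
  "((\<lambda>t. exp (complex_of_real (t - t0) * z)) has_vector_derivative z * exp (of_real (t - t0) * z))
    (at t within S)"
proof -
  have "((\<lambda>w. exp (w * z)) has_field_derivative z * exp (of_real (t - t0) * z)) (at (of_real (t - t0)))"
    by (auto intro!: derivative_eq_intros)
  moreover have "((\<lambda>t. complex_of_real (t - t0)) has_vector_derivative 1) (at t within S)"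
    by (auto intro!: derivative_eq_intros)
  ultimately show ?thesis
    using field_vector_diff_chain_within[of "\<lambda>t. complex_of_real (t - t0)" 1 t S "\<lambda>w. exp (w * z)"]
    by (simp add: o_def has_field_derivative_at_within)
qed

lemma has_vector_derivative_dexp:
  "((\<lambda>t. dexp d (t - t0)) has_vector_derivative diagm d ** dexp d (t - t0)) (at t within S)"
proof (intro has_vector_derivative_vecI)
  fix i j
  show "((\<lambda>t. dexp d (t - t0) $ i $ j) has_vector_derivative (diagm d ** dexp d (t - t0)) $ i $ j)
    (at t within S)"
    using has_vector_derivative_exp_linear[of t0 "d i"] by (cases "i = j") (simp_all add: dexp_def diagm_nth)
qed

lemma dexp_0: "dexp d 0 = mat 1"
  by (simp add: dexp_def diagm_one)

section \<open>The projection in the Toda field\<close>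

lemma su_bor_unique:
  assumes "K \<in> su" "K' \<in> su" "X - K \<in> bor" "X - K' \<in> bor"
  shows "K = K'"
proof -
  have skew: "K $ i $ j = - cnj (K $ j $ i)" "K' $ i $ j = - cnj (K' $ j $ i)" for i j
    using assms(1,2) by (auto simp: su_def adj_def vec_eq_iff)
  have low: "K $ i $ j = K' $ i $ j" if "j < i" for i j
    using assms(3,4) that by (auto simp: bor_def)
  have "Im (K $ i $ i) = Im (K' $ i $ i)" for i
    using assms(3,4) by (auto simp: bor_def)
  moreover have "Re (K $ i $ i) = 0" "Re (K' $ i $ i) = 0" for i
    using skew[of i i] by (simp_all add: complex_eq_iff)
  ultimately have diag: "K $ i $ i = K' $ i $ i" for i
    by (simp add: complex_eq_iff)
  have "K $ i $ j = K' $ i $ j" for i j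
  proof (cases i j rule: linorder_cases)
    case less
    then show ?thesis
      using skew[of i j] low[of i j] by simp
  qed (use low diag in auto)
  then show ?thesis
    by (simp add: vec_eq_iff)
qed

text \<open>Closed form of the projection \<open>pik\<close> on traceless matrices. Subtracting an
  element of \<open>bor\<close> cannot alter the strictly lower part or the imaginary parts of the
  diagonal, and skew symmetry dictates the rest. Continuity is visible here, unlike in the definite
  description.\<close>

definition skewpart :: "'n::{finite,linorder} cmat \<Rightarrow> 'n cmat" where
  "skewpart X = (\<chi> i j. if j < i then X $ i $ j else if i < j then - cnj (X $ j $ i)
     else \<i> * of_real (Im (X $ i $ i)))"

lemma skewpart_su_bor:
  assumes "X \<in> sl"
  shows "skewpart X \<in> su" "X - skewpart X \<in> bor"
proof -
  have "trace (skewpart X) = \<i> * of_real (Im (trace X))"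
    by (simp add: trace_def skewpart_def sum_distrib_left)
  then have tr: "trace (skewpart X) = 0"
    using assms by (simp add: sl_def)
  have "adj (skewpart X) = - skewpart X"
    by (auto simp: adj_def skewpart_def vec_eq_iff complex_eq_iff)
  then show "skewpart X \<in> su"
    by (simp add: su_def tr)
  show "X - skewpart X \<in> bor"
    using assms by (simp add: bor_def trace_sub tr sl_def) (simp add: skewpart_def)
qed

lemma pik_eq: "X \<in> sl \<Longrightarrow> pik X = skewpart X"
  unfolding pik_def using skewpart_su_bor su_bor_unique by (intro the_equality) blast+

lemma continuous_on_skewpart:
  assumes "continuous_on S f"
  shows "continuous_on S (\<lambda>x. skewpart (f x))"
proof -
  have "continuous_on S (\<lambda>x. skewpart (f x) $ i $ j)" for i j
    by (cases i j rule: linorder_cases)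
      (simp_all add: skewpart_def order_less_not_sym continuous_intros assms)
  then have "continuous_on S (\<lambda>x. \<chi> i j. skewpart (f x) $ i $ j)"
    by (intro continuous_on_vec_lambda)
  then show ?thesis
    by simp
qed

text \<open>A real-linear map whose kernel is the space of upper triangular matrices with real
  diagonal; it measures the distance of a matrix from that space.\<close>

definition lowpart :: "'n::{finite,linorder} cmat \<Rightarrow> 'n cmat" where
  "lowpart A = (\<chi> i j. if j < i then A $ i $ j else if i = j then \<i> * of_real (Im (A $ i $ i)) else 0)"

lemma bounded_linear_lowpart: "bounded_linear (lowpart :: 'n::{finite,linorder} cmat \<Rightarrow> 'n cmat)"
  unfolding linear_conv_bounded_linear[symmetric] linear_iff
  by (auto simp: lowpart_def vec_eq_iff complex_eq_iff)

lemma lowpart_eq_0_iff: "lowpart A = 0 \<longleftrightarrow> uptri A \<and> (\<forall>i. Im (A $ i $ i) = 0)"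
  by (auto simp: lowpart_def vec_eq_iff uptri_def)

text \<open>The kernel of \<open>lowpart\<close> is stable under left multiplication by such a
  \<open>B\<close>. Hence \<open>R' = B R\<close> induces a closed linear equation for
  \<open>lowpart R\<close>.\<close>

lemma lowpart_bor_mult:
  assumes "uptri B" "\<And>i. Im (B $ i $ i) = 0"
  shows "lowpart (B ** R) = lowpart (B ** lowpart R)"
proof -
  interpret bounded_linear "lowpart :: 'a cmat \<Rightarrow> 'a cmat"
    by (rule bounded_linear_lowpart)
  define D where "D = R - lowpart R"
  have "lowpart D = 0"
    by (auto simp: D_def lowpart_def vec_eq_iff complex_eq_iff)
  then have "lowpart (B ** D) = 0"
    using assms by (simp add: lowpart_eq_0_iff uptri_mult uptri_mult_diag)
  then show ?thesis
    by (simp add: D_def matrix_diff_distribs diff)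
qed

text \<open>\<open>lowpart (R s)\<close> vanishes at \<open>t0\<close> and its derivative is bounded
  by a multiple of its norm, so it vanishes nearby. Positivity of the diagonal persists near
  \<open>t0\<close> by continuity.\<close>

lemma upper_solution_of_upper_ode:
  fixes B R :: "real \<Rightarrow> 'n::{finite,linorder} cmat"
  assumes t0: "p < t0" "t0 < q"
    and R: "\<And>s. s \<in> {p..q} \<Longrightarrow> (R has_vector_derivative B s ** R s) (at s within {p..q})"
    and B: "continuous_on {p..q} B" "\<And>s. s \<in> {p..q} \<Longrightarrow> B s \<in> bor"
    and init: "R t0 = mat 1"
  shows "\<forall>\<^sub>F s in nhds t0. uptri (R s) \<and> posdiag (R s)"
proof -
  obtain K where K: "K > 0" "\<And>(x :: 'n cmat) (y :: 'n cmat). norm (x ** y) \<le> norm x * norm y * K"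
    using bounded_bilinear.pos_bounded[OF bounded_bilinear_matrix_mult[where 'n = 'n]] by auto
  obtain J where J: "J > 0" "\<And>x :: 'n cmat. norm (lowpart x) \<le> norm x * J"
    using bounded_linear.pos_bounded[OF bounded_linear_lowpart[where 'n = 'n]] by auto
  have "bounded (B ` {p..q})"
    using B by (intro compact_imp_bounded compact_continuous_image) auto
  then obtain M where M: "M > 0" "\<And>s. s \<in> {p..q} \<Longrightarrow> norm (B s) \<le> M"
    by (auto simp: bounded_pos)
  have low: "\<forall>\<^sub>F s in nhds t0. lowpart (R s) = 0"
  proof (rule linear_bound_solution_zero[OF t0])
    fix s assume s: "s \<in> {p..q}"
    show "((\<lambda>s. lowpart (R s)) has_vector_derivative lowpart (B s ** R s)) (at s within {p..q})"
      by (rule bounded_linear.has_vector_derivative[OF bounded_linear_lowpart R[OF s]])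
    have "lowpart (B s ** R s) = lowpart (B s ** lowpart (R s))"
      using B(2)[OF s] by (intro lowpart_bor_mult) (auto simp: bor_def uptri_def)
    then have "norm (lowpart (B s ** R s)) \<le> norm (B s ** lowpart (R s)) * J"
      using J by simp
    also have "\<dots> \<le> (norm (B s) * norm (lowpart (R s)) * K) * J"
      using K J by (intro mult_right_mono) auto
    also have "\<dots> \<le> (M * norm (lowpart (R s)) * K) * J"
      using K J M(2)[OF s] by (intro mult_right_mono) auto
    finally show "norm (lowpart (B s ** R s)) \<le> (M * K * J) * norm (lowpart (R s))"
      by (simp add: algebra_simps)
  next
    show "lowpart (R t0) = 0"
      by (simp add: init lowpart_eq_0_iff uptri_def mat_def)
  qed
  have "continuous (at t0 within {p..q}) R"
    by (rule has_vector_derivative_continuous[OF R]) (use t0 in simp)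
  then have "(R \<longlongrightarrow> R t0) (at t0)"
    using t0 by (simp add: continuous_within at_within_Icc_at)
  then have R_lim: "(R \<longlongrightarrow> R t0) (nhds t0)"
    using tendsto_at_iff_tendsto_nhds by blast
  have "\<forall>\<^sub>F s in nhds t0. 0 < Re (R s $ i $ i)" for i
  proof (rule order_tendstoD)
    show "((\<lambda>s. Re (R s $ i $ i)) \<longlongrightarrow> Re (R t0 $ i $ i)) (nhds t0)"
      by (intro tendsto_intros R_lim)
    show "0 < Re (R t0 $ i $ i)"
      by (simp add: init mat_def)
  qed
  then have "\<forall>\<^sub>F s in nhds t0. \<forall>i. 0 < Re (R s $ i $ i)"
    by (simp add: eventually_all_finite)
  with low show ?thesis
    by eventually_elim (auto simp: lowpart_eq_0_iff posdiag_def)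
qed

text \<open>The QR factorization of the exponential is produced by solving an equation for
  \<open>Q\<close> and checking that the complementary factor \<open>R\<close> stays upper
  triangular. A neighbourhood of \<open>t0\<close> suffices for computing a derivative
  there.\<close>

lemma toda_local_factorization:
  fixes gam :: "real \<Rightarrow> 'n::{finite,linorder} cmat"
  assumes t0: "t0 \<in> {a<..<b}"
    and gam: "\<And>t. t \<in> {a<..<b} \<Longrightarrow> gam t \<in> sl"
      "\<And>t. t \<in> {a<..<b} \<Longrightarrow> (gam has_vector_derivative toda (gam t)) (at t)"
    and g: "det g \<noteq> 0" "gam t0 = matrix_inv g ** diagm lam ** g"
  shows "\<forall>\<^sub>F s in nhds t0. \<exists>Q R. adj Q ** Q = mat 1 \<and> uptri R \<and> posdiag R \<and>
    Q ** R = matrix_inv g ** dexp lam (s - t0) ** g \<and> gam s = adj Q ** gam t0 ** Q"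
proof -
  obtain a' b' where ab: "a < a'" "a' < t0" "t0 < b'" "b' < b"
    using t0 dense by (meson greaterThanLessThan_iff)
  define A where "A s = skewpart (gam s)" for s
  have cont: "continuous_on {a'..b'} gam"
    by (intro continuous_at_imp_continuous_on ballI has_vector_derivative_continuous[OF gam(2)])
      (use ab in auto)
  then have "continuous_on {a'..b'} A"
    unfolding A_def by (rule continuous_on_skewpart)
  then obtain p q Q0 where pq: "a' \<le> p" "p < t0" "t0 < q" "q \<le> b'" and "Q0 p = mat 1"
    and Q0: "\<And>s. s \<in> {p..q} \<Longrightarrow> (Q0 has_vector_derivative Q0 s ** A s) (at s within {p..q})"
    using linear_matrix_ode_exists[OF ab(2,3)] by metis
  let ?I = "{p..q}"
  have sub: "s \<in> {a<..<b}" if "s \<in> ?I" for s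
    using that pq ab by auto
  have X: "(gam has_vector_derivative gam s ** A s - A s ** gam s) (at s within ?I)" if "s \<in> ?I" for s
    using gam(2)[OF sub[OF that]] gam(1)[OF sub[OF that]]
    by (simp add: toda_def comm_def pik_eq A_def has_vector_derivative_at_within)
  have skew: "adj (A s) = - A s" and borel: "gam s - A s \<in> bor" if "s \<in> ?I" for s
    using skewpart_su_bor[OF gam(1)[OF sub[OF that]]] by (simp_all add: A_def su_def)
  have Q0Q0: "Q0 s ** adj (Q0 s) = mat 1" if s: "s \<in> ?I" for s
  proof -
    have "((\<lambda>s. Q0 s ** adj (Q0 s)) has_vector_derivative 0) (at s within ?I)" if s: "s \<in> ?I" for s
    proof -
      have "((\<lambda>s. Q0 s ** adj (Q0 s)) has_vector_derivative
          (Q0 s ** adj (Q0 s ** A s) + Q0 s ** A s ** adj (Q0 s))) (at s within ?I)"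
        by (intro has_vector_derivative_matrix_mult has_vector_derivative_adj Q0 s)
      moreover have "Q0 s ** adj (Q0 s ** A s) + Q0 s ** A s ** adj (Q0 s) = 0"
        by (simp add: adj_mult skew[OF s] matrix_diff_distribs matrix_mul_assoc)
      ultimately show ?thesis
        by simp
    qed
    then have "Q0 s ** adj (Q0 s) = Q0 p ** adj (Q0 p)"
      by (rule zero_vector_derivative_const[where p = p and q = q]) (use s pq in auto)
    then show ?thesis
      by (simp add: \<open>Q0 p = mat 1\<close>)
  qed
  \<comment> \<open>\<open>Q0\<close> is normalized at \<open>p\<close>. Left multiplication by the
    constant unitary \<open>adj (Q0 t0)\<close> preserves the equation and moves the normalization
    to \<open>t0\<close>.\<close>
  define Q where "Q s = adj (Q0 t0) ** Q0 s" for s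
  have t0I: "t0 \<in> ?I"
    using pq by simp
  have Q: "(Q has_vector_derivative Q s ** A s) (at s within ?I)" if s: "s \<in> ?I" for s
    using has_vector_derivative_matrix_mult[OF has_vector_derivative_const Q0[OF s], of "adj (Q0 t0)"]
    by (simp add: Q_def[abs_def] matrix_mul_assoc)
  have Q't0: "adj (Q0 t0) ** Q0 t0 = mat 1"
    using Q0Q0[OF t0I] matrix_left_right_inverse by blast
  have Qt0: "Q t0 = mat 1"
    by (simp add: Q_def Q't0)
  have QQ: "adj (Q s) ** Q s = mat 1" if s: "s \<in> ?I" for s
  proof -
    have "adj (Q s) ** Q s = adj (Q0 s) ** (Q0 t0 ** adj (Q0 t0)) ** Q0 s"
      by (simp add: Q_def adj_mult matrix_mul_assoc)
    also have "\<dots> = adj (Q0 s) ** Q0 s"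
      by (simp add: Q0Q0[OF t0I])
    also have "\<dots> = mat 1"
      using Q0Q0[OF s] matrix_left_right_inverse by blast
    finally show ?thesis .
  qed
  have Q': "((\<lambda>s. adj (Q s)) has_vector_derivative - (A s ** adj (Q s))) (at s within ?I)"
    if s: "s \<in> ?I" for s
    using has_vector_derivative_adj[OF Q[OF s]]
    by (simp add: adj_mult skew[OF s] matrix_diff_distribs)
  \<comment> \<open>Isospectrality: the commutator in the Toda equation cancels against the
    derivatives of the two unitary factors.\<close>
  have "Q s ** gam s ** adj (Q s) = Q t0 ** gam t0 ** adj (Q t0)" if s: "s \<in> ?I" for s
  proof (rule zero_vector_derivative_const[OF _ s t0I])
    fix s assume s: "s \<in> ?I"
    have "((\<lambda>s. Q s ** gam s ** adj (Q s)) has_vector_derivative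
      (Q s ** gam s ** - (A s ** adj (Q s)) +
       (Q s ** (gam s ** A s - A s ** gam s) + Q s ** A s ** gam s) ** adj (Q s))) (at s within ?I)"
      by (intro has_vector_derivative_matrix_mult Q Q' X s)
    moreover have "Q s ** gam s ** - (A s ** adj (Q s)) +
       (Q s ** (gam s ** A s - A s ** gam s) + Q s ** A s ** gam s) ** adj (Q s) = 0"
      by (simp add: matrix_diff_distribs matrix_mul_assoc)
    ultimately show "((\<lambda>s. Q s ** gam s ** adj (Q s)) has_vector_derivative 0) (at s within ?I)"
      by simp
  qed
  then have conj: "Q s ** gam s ** adj (Q s) = gam t0" if "s \<in> ?I" for s
    using that by (simp add: Qt0)
  define E where "E s = matrix_inv g ** dexp lam (s - t0) ** g" for s
  have E: "(E has_vector_derivative gam t0 ** E s) (at s within ?I)" for s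
  proof -
    have "((\<lambda>s. matrix_inv g ** dexp lam (s - t0) ** g) has_vector_derivative
        (matrix_inv g ** dexp lam (s - t0)) ** 0 +
        (matrix_inv g ** (diagm lam ** dexp lam (s - t0)) + 0 ** dexp lam (s - t0)) ** g) (at s within ?I)"
      by (intro has_vector_derivative_matrix_mult has_vector_derivative_const has_vector_derivative_dexp)
    moreover have "gam t0 ** E s = matrix_inv g ** diagm lam ** (g ** matrix_inv g) ** dexp lam (s - t0) ** g"
      by (simp add: g(2) E_def matrix_mul_assoc)
    ultimately show ?thesis
      using g(1) by (simp add: E_def[abs_def] matrix_inv_right matrix_mul_assoc)
  qed
  define R where "R s = adj (Q s) ** E s" for s
  \<comment> \<open>Moving \<open>gam t0\<close> past \<open>adj (Q s)\<close> turns it into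
    \<open>gam s\<close>, so the coefficient becomes \<open>gam s - A s\<close>, the Borel
    component.\<close>
  have R: "(R has_vector_derivative (gam s - A s) ** R s) (at s within ?I)" if s: "s \<in> ?I" for s
  proof -
    have "((\<lambda>s. adj (Q s) ** E s) has_vector_derivative
        adj (Q s) ** (gam t0 ** E s) + (- (A s ** adj (Q s))) ** E s) (at s within ?I)"
      by (intro has_vector_derivative_matrix_mult Q' E s)
    moreover have "adj (Q s) ** (gam t0 ** E s) = (adj (Q s) ** Q s) ** gam s ** adj (Q s) ** E s"
      by (simp add: matrix_mul_assoc flip: conj[OF s])
    ultimately show ?thesis
      by (simp add: R_def[abs_def] QQ[OF s] matrix_diff_distribs matrix_mul_assoc)
  qed
  have "\<forall>\<^sub>F s in nhds t0. uptri (R s) \<and> posdiag (R s)"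
  proof (rule upper_solution_of_upper_ode[OF pq(2,3) R])
    show "continuous_on ?I (\<lambda>s. gam s - A s)"
      unfolding A_def using pq
      by (intro continuous_on_diff continuous_on_skewpart continuous_on_subset[OF cont]) auto
    show "R t0 = mat 1"
      using g(1) by (simp add: R_def Qt0 E_def dexp_0 matrix_inv_left)
  qed (use borel in auto)
  moreover have "\<forall>\<^sub>F s in nhds t0. s \<in> {p<..<q}"
    using pq by (intro eventually_nhds_in_open) auto
  ultimately show ?thesis
  proof eventually_elim
    case (elim s)
    then have s: "s \<in> ?I"
      by simp
    have QQ': "Q s ** adj (Q s) = mat 1"
      using QQ[OF s] matrix_left_right_inverse by blast
    have "Q s ** R s = E s"
      unfolding R_def by (simp add: matrix_mul_assoc QQ')
    moreover have "adj (Q s) ** gam t0 ** Q s = (adj (Q s) ** Q s) ** gam s ** (adj (Q s) ** Q s)"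
      by (simp add: matrix_mul_assoc flip: conj[OF s])
    then have "gam s = adj (Q s) ** gam t0 ** Q s"
      by (simp add: QQ[OF s])
    ultimately show ?case
      using QQ[OF s] elim unfolding E_def by blast
  qed
qed

section \<open>The linear flow\<close>

text \<open>Conjugation by the one-parameter group of \<open>diagm d\<close>, oriented so that it
  solves \<open>Y' = comm Y (diagm d)\<close>.\<close>

definition flow :: "('n::finite \<Rightarrow> complex) \<Rightarrow> real \<Rightarrow> 'n cmat \<Rightarrow> 'n cmat" where
  "flow d t Y = dexp d (- t) ** Y ** dexp d t"

lemma dexp_neg_mult:
  "dexp d (- t) ** dexp d t = mat 1" "dexp d t ** dexp d (- t) = mat 1"
  by (simp_all add: dexp_def diagm_mult diagm_one flip: exp_add)

lemma dexp_neg_cancel: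
  "dexp d (- t) ** (dexp d t ** A) = A" "dexp d t ** (dexp d (- t) ** A) = A"
  by (simp_all add: matrix_mul_assoc dexp_neg_mult)

lemma flow_nth: "flow d t Y $ i $ j = Y $ i $ j * exp (of_real t * (d j - d i))"
  by (simp add: flow_def dexp_def algebra_simps exp_diff exp_minus divide_inverse)

lemma flow_0: "flow d 0 Y = Y"
  by (simp add: vec_eq_iff flow_nth)

lemma flow_mult: "flow d t (A ** B) = flow d t A ** flow d t B"
  unfolding flow_def by (simp add: dexp_neg_cancel flip: matrix_mul_assoc)

lemma flow_diagm: "flow d t (diagm e) = diagm e"
  by (simp add: vec_eq_iff flow_nth diagm_nth)

lemma matrix_inv_flow:
  assumes "det A \<noteq> 0"
  shows "matrix_inv (flow d t A) = flow d t (matrix_inv A)"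
proof (rule matrix_inv_eqI)
  show "flow d t A ** flow d t (matrix_inv A) = mat 1"
    by (simp add: matrix_inv_right[OF assms] flow_diagm flip: flow_mult diagm_one)
qed

lemma Lgrp_flow: "l \<in> Lgrp \<Longrightarrow> flow d t l \<in> Lgrp"
  by (simp add: Lgrp_def flow_nth)

lemma conjm_flow:
  assumes "l \<in> Lgrp"
  shows "conjm (matrix_inv (flow d t l)) (diagm e) = flow d t (conjm (matrix_inv l) (diagm e))"
proof -
  have "det l \<noteq> 0" "det (flow d t l) \<noteq> 0"
    using det_Lgrp assms Lgrp_flow by (metis one_neq_zero)+
  then show ?thesis
    unfolding conjm_matrix_inv[OF \<open>det l \<noteq> 0\<close>] conjm_matrix_inv[OF \<open>det (flow d t l) \<noteq> 0\<close>]
    by (simp add: matrix_inv_flow flow_mult flow_diagm)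
qed

lemma comm_diagm_nth: "comm Y (diagm d) $ i $ j = Y $ i $ j * (d j - d i)"
  by (simp add: comm_def algebra_simps)

lemma flow_has_vector_derivative:
  "((\<lambda>t. flow d (t - t0) Y) has_vector_derivative comm (flow d (t - t0) Y) (diagm d)) (at t within S)"
proof (intro has_vector_derivative_vecI)
  fix i j
  show "((\<lambda>t. flow d (t - t0) Y $ i $ j) has_vector_derivative
      comm (flow d (t - t0) Y) (diagm d) $ i $ j) (at t within S)"
    using has_vector_derivative_mult_right[OF has_vector_derivative_exp_linear[of t0 "d j - d i" t S],
        of "Y $ i $ j"]
    by (simp add: flow_nth comm_diagm_nth algebra_simps)
qed

text \<open>Each entry satisfies a scalar equation with rate \<open>d j - d i\<close>. Multiplying
  by the integrating factor gives a constant on a symmetric interval containing both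
  \<open>0\<close> and \<open>t\<close>.\<close>

lemma commutator_ode_solution_eq_flow:
  assumes y: "\<And>t. (y has_vector_derivative comm (y t) (diagm d)) (at t)"
  shows "y t = flow d t (y 0)"
proof -
  have "y t $ i $ j = flow d t (y 0) $ i $ j" for i j
  proof -
    let ?z = "d i - d j"
    have "((\<lambda>t. y t $ i $ j * exp (of_real (t - 0) * ?z)) has_vector_derivative 0) (at s)" for s
    proof -
      have "((\<lambda>t. y t $ i $ j) has_vector_derivative y s $ i $ j * (d j - d i)) (at s)"
        using bounded_linear.has_vector_derivative[OF bounded_linear_vec_nth
            bounded_linear.has_vector_derivative[OF bounded_linear_vec_nth y[of s], of i], of j]
        by (simp add: comm_diagm_nth)
      from has_vector_derivative_mult[OF this has_vector_derivative_exp_linear[of 0 ?z s]]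
      show ?thesis
        by (simp add: algebra_simps)
    qed
    then have "y t $ i $ j * exp (of_real (t - 0) * ?z) = y 0 $ i $ j * exp (of_real (0 - 0) * ?z)"
      by (intro zero_vector_derivative_const[where p = "- \<bar>t\<bar>" and q = "\<bar>t\<bar>"])
        (auto intro: has_vector_derivative_at_within)
    then have "y 0 $ i $ j * exp (of_real t * (d j - d i)) = y t $ i $ j * (exp (of_real t * ?z) * exp (of_real t * (d j - d i)))"
      by simp
    also have "exp (of_real t * ?z) * exp (of_real t * (d j - d i)) = 1"
      by (simp add: algebra_simps flip: exp_add)
    finally show ?thesis
      by (simp add: flow_nth)
  qed
  then show ?thesis
    by (simp add: vec_eq_iff)
qed

abbreviation imdiag :: "('n \<Rightarrow> complex) \<Rightarrow> 'n \<Rightarrow> complex" where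
  "imdiag lam \<equiv> \<lambda>j. \<i> * complex_of_real (Im (lam j))"

abbreviation negrediag :: "('n \<Rightarrow> complex) \<Rightarrow> 'n \<Rightarrow> complex" where
  "negrediag lam \<equiv> \<lambda>j. - complex_of_real (Re (lam j))"

lemma linYZ_eq:
  "linYZ lam p = (comm (fst p) (diagm (imdiag lam)), comm (snd p) (diagm (negrediag lam)))"
proof -
  have "- diagm (\<lambda>j. complex_of_real (Re (lam j))) = diagm (negrediag lam)"
    by (simp add: vec_eq_iff diagm_nth)
  then show ?thesis
    by (simp add: linYZ_def)
qed

section \<open>The linear field on the affine space\<close>

lemma aff_iff: "Y \<in> aff Lam \<longleftrightarrow> (\<forall>i j. i \<le> j \<longrightarrow> Y $ i $ j = Lam $ i $ j)"
proof
  assume "\<forall>i j. i \<le> j \<longrightarrow> Y $ i $ j = Lam $ i $ j"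
  then have "Y = Lam + (Y - Lam)" "Y - Lam \<in> lalg"
    by (simp_all add: lalg_def)
  then show "Y \<in> aff Lam"
    unfolding aff_def by blast
qed (auto simp: aff_def lalg_def)

lemma flow_aff:
  assumes "Y \<in> aff (diagm lam)"
  shows "flow d t Y \<in> aff (diagm lam)"
  using assms by (auto simp: aff_iff flow_nth diagm_nth)

lemma comm_diagm_lalg:
  assumes "Y \<in> aff (diagm lam)"
  shows "comm Y (diagm d) \<in> lalg"
  using assms by (auto simp: aff_iff lalg_def comm_diagm_nth diagm_nth)

text \<open>The polar decomposition of the exponential. Because \<open>negrediag\<close> already
  carries the minus sign of the second component of the field, the positive factor appears at time
  \<open>- t\<close>.\<close>

lemma dexp_split: "dexp lam t = dexp (imdiag lam) t ** dexp (negrediag lam) (- t)"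
proof -
  have "complex_of_real t * lam i
      = complex_of_real t * imdiag lam i + complex_of_real (- t) * negrediag lam i" for i
    by (simp add: complex_eq_iff)
  then have "exp (complex_of_real t * lam i)
      = exp (complex_of_real t * imdiag lam i) * exp (complex_of_real (- t) * negrediag lam i)" for i
    by (simp only: exp_add)
  then show ?thesis
    by (simp only: dexp_def diagm_mult)
qed

lemma adj_dexp_imdiag: "adj (dexp (imdiag lam) t) = dexp (imdiag lam) (- t)"
  by (simp add: dexp_def adj_diagm exp_cnj)

text \<open>At the later time the (Y, Z) data are read off again through \<open>phiYZ_eq\<close>,
  applied to \<open>l1\<close> and \<open>m1 = matrix_inv l1 ** l2\<close>. The point is that
  \<open>k ** u\<close> is the Iwasawa factorization of \<open>m1\<close>.\<close>

lemma phiYZ_toda_step: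
  fixes l m :: "'n::{finite,linorder} cmat"
  assumes inj: "inj lam" and l: "l \<in> Lgrp" and m: "m \<in> Lgrp"
    and g: "g = l ** kappa m"
    and Q: "adj Q ** Q = mat 1" and R: "uptri R" "posdiag R"
    and QR: "Q ** R = matrix_inv g ** dexp lam t ** g"
    and X: "X = adj Q ** (matrix_inv g ** diagm lam ** g) ** Q"
  shows "phiYZ (diagm lam) X =
    (flow (imdiag lam) t (conjm (matrix_inv l) (diagm lam)),
     flow (negrediag lam) t (conjm (matrix_inv (l ** m)) (diagm lam)))"
proof -
  define k0 where "k0 = kappa m"
  define u0 where "u0 = nu m"
  have k0: "k0 \<in> SUn" and u0: "u0 \<in> Ugrp" and m0: "m = k0 ** u0"
    using Lgrp_iwasawa[OF m] by (simp_all add: k0_def u0_def)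
  have gk: "g = l ** k0"
    by (simp add: g k0_def)
  let ?V = "dexp (imdiag lam) t"
  let ?V' = "dexp (imdiag lam) (- t)"
  let ?P = "dexp (negrediag lam) (- t)"
  let ?P' = "dexp (negrediag lam) t"
  define l1 where "l1 = flow (imdiag lam) t l"
  define l2 where "l2 = flow (negrediag lam) t (l ** m)"
  have L: "l1 \<in> Lgrp" "l2 \<in> Lgrp"
    using l m by (simp_all add: l1_def l2_def Lgrp_flow Lgrp_mult)
  have det: "det l \<noteq> 0" "det l1 \<noteq> 0" "det k0 \<noteq> 0" "det g \<noteq> 0"
    using l L k0 by (simp_all add: det_Lgrp SUnD gk det_mul)
  define m1 where "m1 = matrix_inv l1 ** l2"
  have m1: "m1 \<in> Lgrp"
    unfolding m1_def using L by (intro Lgrp_mult Lgrp_matrix_inv)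
  define k where "k = ?V' ** k0 ** Q"
  define u where "u = R ** u0 ** ?P'"
  \<comment> \<open>The exponential splits as \<open>?V ** ?P\<close>: \<open>?V'\<close> and
    \<open>?V\<close> conjugate \<open>matrix_inv l\<close> into the inverse of \<open>l1\<close>,
    while \<open>?P\<close> and \<open>?P'\<close> conjugate \<open>l ** m\<close> into
    \<open>l2\<close>.\<close>
  have "k ** u = ?V' ** k0 ** (Q ** R) ** u0 ** ?P'"
    by (simp add: k_def u_def matrix_mul_assoc)
  also have "\<dots> = ?V' ** (k0 ** matrix_inv g) ** ?V ** ?P ** (g ** u0) ** ?P'"
    by (simp add: QR dexp_split[of lam] matrix_mul_assoc)
  also have "k0 ** matrix_inv g = matrix_inv l"
    using det by (simp add: gk matrix_inv_mult matrix_inv_cancel)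
  also have "g ** u0 = l ** m"
    by (simp add: gk m0 matrix_mul_assoc)
  also have "?V' ** matrix_inv l ** ?V ** ?P ** (l ** m) ** ?P' = m1"
    using det by (simp add: m1_def l1_def l2_def matrix_inv_flow) (simp add: flow_def matrix_mul_assoc)
  finally have ku: "k ** u = m1" .
  have "adj k ** k = mat 1"
    unfolding k_def
    by (simp add: gram_unitary_mult adj_dexp_imdiag dexp_neg_mult SUnD(2)[OF k0] Q flip: matrix_mul_assoc)
  moreover have "uptri u"
    unfolding u_def dexp_def using R u0 by (intro uptri_mult uptri_diagm) (simp_all add: Ugrp_iff)
  moreover have "posdiag u"
  proof (rule posdiagI)
    fix i
    obtain r s where rs: "r > 0" "R $ i $ i = complex_of_real r" "s > 0" "u0 $ i $ i = complex_of_real s"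
      using u0 R(2) by (metis Ugrp_iff posdiagE)
    have "exp (complex_of_real t * negrediag lam i) = of_real (exp (- t * Re (lam i)))"
      by (simp add: exp_of_real[symmetric])
    then have "u $ i $ i = of_real (r * s * exp (- t * Re (lam i)))"
      unfolding u_def dexp_def using R u0 rs by (simp add: uptri_mult_diag Ugrp_iff)
    then show "\<exists>r>0. u $ i $ i = complex_of_real r"
      using rs by (metis exp_gt_zero mult_pos_pos)
  qed
  ultimately have KU: "k \<in> SUn" "u \<in> Ugrp"
    using unitary_upper_det1[of k u] ku det_Lgrp[OF m1] by simp_all
  have kappa: "kappa m1 = k"
    using kappa_nu_eqI[OF KU] ku by simp
  have "l1 ** k = ?V' ** g ** Q"
    by (simp add: l1_def flow_def k_def gk dexp_neg_cancel flip: matrix_mul_assoc)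
  moreover have "matrix_inv (?V' ** g ** Q) = adj Q ** matrix_inv g ** ?V"
  proof (rule matrix_inv_eqI)
    have "Q ** adj Q = mat 1"
      using Q matrix_left_right_inverse by blast
    have "?V' ** g ** Q ** (adj Q ** matrix_inv g ** ?V) = ?V' ** (g ** (Q ** adj Q) ** matrix_inv g) ** ?V"
      by (simp add: matrix_mul_assoc)
    also have "\<dots> = mat 1"
      by (simp add: \<open>Q ** adj Q = mat 1\<close> matrix_inv_right det dexp_neg_mult)
    finally show "?V' ** g ** Q ** (adj Q ** matrix_inv g ** ?V) = mat 1" .
  qed
  moreover have "conjm (matrix_inv (l1 ** k)) (diagm lam) = matrix_inv (l1 ** k) ** diagm lam ** (l1 ** k)"
    using L KU by (intro conjm_matrix_inv) (simp add: det_mul det_Lgrp SUnD)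
  ultimately have "conjm (matrix_inv (l1 ** k)) (diagm lam)
      = (adj Q ** matrix_inv g ** ?V) ** diagm lam ** (?V' ** g ** Q)"
    by simp
  also have "\<dots> = adj Q ** matrix_inv g ** (?V ** diagm lam ** ?V') ** g ** Q"
    by (simp add: matrix_mul_assoc)
  \<comment> \<open>Diagonal matrices commute, so the unitary part of the exponential drops out of
    the conjugate of \<open>diagm lam\<close>.\<close>
  also have "?V ** diagm lam ** ?V' = diagm lam"
    using flow_diagm[of "imdiag lam" "- t" lam] by (simp add: flow_def)
  finally have "X = conjm (matrix_inv (l1 ** kappa m1)) (diagm lam)"
    by (simp add: X kappa matrix_mul_assoc)
  then have "phiYZ (diagm lam) X =
      (conjm (matrix_inv l1) (diagm lam), conjm (matrix_inv (l1 ** m1)) (diagm lam))"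
    by (rule phiYZ_eq[OF inj L(1) m1])
  also have "l1 ** m1 = l2"
    using det by (simp add: m1_def matrix_inv_cancel)
  finally show ?thesis
    unfolding l1_def l2_def using l m by (simp add: conjm_flow Lgrp_mult)
qed

section \<open>Derivatives along Toda trajectories\<close>

lemma conjm_sl:
  assumes "det g \<noteq> 0" "X \<in> sl"
  shows "conjm (matrix_inv g) X \<in> sl"
proof -
  have "trace (matrix_inv g ** X ** g) = trace (g ** (matrix_inv g ** X))"
    by (rule trace_mul_sym)
  then show ?thesis
    using assms by (simp add: sl_def conjm_matrix_inv matrix_inv_cancel)
qed

lemma Uset_obtain:
  assumes "X \<in> Uset Lam"
  obtains l m where "l \<in> Lgrp" "m \<in> Lgrp" "X = conjm (matrix_inv (l ** kappa m)) Lam"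
    "det (l ** kappa m) \<noteq> 0"
  using assms Lgrp_iwasawa(1)
  by (fastforce simp: Uset_def Cset_def det_mul det_Lgrp SUnD)

text \<open>Near the chosen time the transformed trajectory coincides with the explicit curve
  \<open>F\<close> of the linear flow, and derivatives depend only on such germs. The decomposition
  data are chosen anew at each time \<open>t\<close>.\<close>

lemma phiYZ_toda_has_vector_derivative:
  fixes gam :: "real \<Rightarrow> 'n::{finite,linorder} cmat"
  assumes inj: "inj lam" and sl: "diagm lam \<in> sl" and t: "t \<in> {a<..<b}"
    and U: "\<And>t. t \<in> {a<..<b} \<Longrightarrow> gam t \<in> Uset (diagm lam)"
    and gam: "\<And>t. t \<in> {a<..<b} \<Longrightarrow> (gam has_vector_derivative toda (gam t)) (at t)"
  shows "((\<lambda>s. phiYZ (diagm lam) (gam s)) has_vector_derivative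
    linYZ lam (phiYZ (diagm lam) (gam t))) (at t)"
proof -
  obtain l m where l: "l \<in> Lgrp" and m: "m \<in> Lgrp"
    and X: "gam t = conjm (matrix_inv (l ** kappa m)) (diagm lam)" and det: "det (l ** kappa m) \<noteq> 0"
    using U[OF t] by (rule Uset_obtain)
  define Y where "Y = conjm (matrix_inv l) (diagm lam)"
  define Z where "Z = conjm (matrix_inv (l ** m)) (diagm lam)"
  have gam_sl: "gam s \<in> sl" if "s \<in> {a<..<b}" for s
    using U[OF that] by (metis Uset_obtain conjm_sl sl)
  define F where "F s = (flow (imdiag lam) (s - t) Y, flow (negrediag lam) (s - t) Z)" for s
  have conj: "gam t = matrix_inv (l ** kappa m) ** diagm lam ** (l ** kappa m)"
    using X det by (simp add: conjm_matrix_inv)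
  have "\<forall>\<^sub>F s in nhds t. \<exists>Q R. adj Q ** Q = mat 1 \<and> uptri R \<and> posdiag R \<and>
      Q ** R = matrix_inv (l ** kappa m) ** dexp lam (s - t) ** (l ** kappa m) \<and>
      gam s = adj Q ** gam t ** Q"
    by (rule toda_local_factorization[OF t gam_sl gam det conj])
  then have phi: "\<forall>\<^sub>F s in nhds t. phiYZ (diagm lam) (gam s) = F s"
  proof eventually_elim
    case (elim s)
    then obtain Q R where "adj Q ** Q = mat 1" "uptri R" "posdiag R"
      "Q ** R = matrix_inv (l ** kappa m) ** dexp lam (s - t) ** (l ** kappa m)"
      "gam s = adj Q ** (matrix_inv (l ** kappa m) ** diagm lam ** (l ** kappa m)) ** Q"
      unfolding conj by blast
    from phiYZ_toda_step[OF inj l m refl this] show ?case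
      by (simp add: F_def Y_def Z_def)
  qed
  \<comment> \<open>The neighbourhood filter includes the point itself, so the agreement with
    \<open>F\<close> also holds at time \<open>t\<close>.\<close>
  then have phi_t: "phiYZ (diagm lam) (gam t) = F t"
    by (rule eventually_nhds_x_imp_x)
  have "(F has_vector_derivative linYZ lam (F t)) (at t)"
    unfolding F_def[abs_def] linYZ_eq fst_conv snd_conv
    by (intro has_vector_derivative_Pair flow_has_vector_derivative)
  then show ?thesis
    using phi phi_t
    by (subst has_vector_derivative_cong_ev[where g = F]) (auto elim: eventually_mono)
qed

section \<open>Boundedness of the linear trajectories\<close>

lemma exp_linear_bounded_imp_zero:
  fixes r x M :: real
  assumes "r > 0" "\<And>t. r * exp (t * x) \<le> M"
  shows "x = 0"
proof (rule ccontr)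
  assume "x \<noteq> 0"
  \<comment> \<open>At \<open>t = M / (r * x)\<close> the assumed bound becomes
    \<open>exp y \<le> y\<close> for \<open>y = M / r\<close>, contradicting
    \<open>1 + y \<le> exp y\<close>.\<close>
  then have "exp (M / r) \<le> M / r"
    using assms(1) assms(2)[of "M / r / x"] by (simp add: field_simps)
  then show False
    using exp_ge_add_one_self[of "M / r"] by linarith
qed

text \<open>The exponents are purely imaginary, so every entry is only multiplied by a phase and the
  orbit stays bounded.\<close>

lemma compact_closure_imaginary_flow:
  "compact (closure (range (\<lambda>t. flow (imdiag lam) t Y)))"
proof -
  have "norm (flow (imdiag lam) t Y) \<le> norm Y" for t
    by (intro norm_le_componentwise_cart) (simp add: flow_nth norm_mult norm_exp_eq_Re)
  then have "bounded (range (\<lambda>t. flow (imdiag lam) t Y))"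
    by (auto simp: bounded_iff)
  then show ?thesis
    by (simp add: compact_closure)
qed

text \<open>A nonzero entry scales by \<open>exp (t * (Re (lam i) - Re (lam j)))\<close>.
  Boundedness over all real times, in both directions, forces the two real parts to agree, so the
  entry is constant.\<close>

lemma bounded_real_flow_stationary:
  assumes "bounded (range (\<lambda>t. flow (negrediag lam) t Z))"
  shows "flow (negrediag lam) t Z = Z"
proof -
  obtain M where M: "\<And>t. norm (flow (negrediag lam) t Z) \<le> M"
    using assms by (auto simp: bounded_iff)
  have "flow (negrediag lam) t Z $ i $ j = Z $ i $ j" for i j
  proof (cases "Z $ i $ j = 0")
    case False
    have "cmod (Z $ i $ j) * exp (t * (Re (lam i) - Re (lam j))) \<le> M" for t
    proof -
      have "cmod (flow (negrediag lam) t Z $ i $ j) \<le> M"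
        by (rule order_trans[OF Finite_Cartesian_Product.norm_nth_le order_trans[OF Finite_Cartesian_Product.norm_nth_le M]])
      then show ?thesis
        by (simp add: flow_nth norm_mult norm_exp_eq_Re)
    qed
    then have "Re (lam i) - Re (lam j) = 0"
      using False by (intro exp_linear_bounded_imp_zero[of "cmod (Z $ i $ j)" _ M]) simp_all
    then show ?thesis
      by (simp add: flow_nth)
  qed (simp add: flow_nth)
  then show ?thesis
    by (simp add: vec_eq_iff)
qed

lemma linYZ_trajectory_eq_flow:
  assumes "\<And>t. (c has_vector_derivative linYZ lam (c t)) (at t)"
  shows "fst (c t) = flow (imdiag lam) t (fst (c 0))" "snd (c t) = flow (negrediag lam) t (snd (c 0))"
  using bounded_linear.has_vector_derivative[OF bounded_linear_fst assms]
    bounded_linear.has_vector_derivative[OF bounded_linear_snd assms]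
  by (intro commutator_ode_solution_eq_flow; simp add: linYZ_eq)+

theorem theorem2p8:
  fixes lam :: "'n::{finite,linorder} \<Rightarrow> complex"
  defines "Lam \<equiv> diagm lam"
  assumes simple: "inj lam"
    and inslc: "Lam \<in> sl"
  shows
    \<comment> \<open>phi transforms Toda trajectories in U into trajectories of the linear field\<close>
    "(\<forall>(gam :: real \<Rightarrow> 'n cmat) a b.
        (\<forall>t\<in>{a<..<b}. gam t \<in> Uset Lam \<and> (gam has_vector_derivative toda (gam t)) (at t))
        \<longrightarrow> (\<forall>t\<in>{a<..<b}. ((\<lambda>s. phiYZ Lam (gam s)) has_vector_derivative
                              linYZ lam (phiYZ Lam (gam t))) (at t)))
     \<and> \<comment> \<open>(i) the linear field is a vector field on the whole affine space, with global flow\<close>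
     (\<forall>Y\<in>aff Lam. \<forall>Z\<in>aff Lam. fst (linYZ lam (Y, Z)) \<in> lalg \<and> snd (linYZ lam (Y, Z)) \<in> lalg)
     \<and> (\<forall>Y0\<in>aff Lam. \<forall>Z0\<in>aff Lam. \<exists>c :: real \<Rightarrow> 'n cmat \<times> 'n cmat. c 0 = (Y0, Z0) \<and>
          (\<forall>t. c t \<in> aff Lam \<times> aff Lam \<and> (c has_vector_derivative linYZ lam (c t)) (at t)))
     \<and> \<comment> \<open>(ii) trajectories\<close>
     (\<forall>c :: real \<Rightarrow> 'n cmat \<times> 'n cmat.
        (\<forall>t. c t \<in> aff Lam \<times> aff Lam \<and> (c has_vector_derivative linYZ lam (c t)) (at t)) \<longrightarrow>
        compact (closure (range (\<lambda>t. fst (c t)))) \<and>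
        (compact (range (\<lambda>t. snd (c t))) \<longleftrightarrow> (\<forall>t. snd (c t) = snd (c 0))))
     \<and> \<comment> \<open>(iii) decoupling in the strictly lower triangular entries\<close>
     (\<exists>f g :: 'n \<Rightarrow> 'n \<Rightarrow> complex \<Rightarrow> complex.
        \<forall>Y\<in>aff Lam. \<forall>Z\<in>aff Lam. \<forall>j k. k < j \<longrightarrow>
          fst (linYZ lam (Y, Z)) $ j $ k = f j k (Y $ j $ k) \<and>
          snd (linYZ lam (Y, Z)) $ j $ k = g j k (Z $ j $ k))"
  unfolding Lam_def
proof (intro conjI)
  show "\<forall>(gam :: real \<Rightarrow> 'n cmat) a b.
      (\<forall>t\<in>{a<..<b}. gam t \<in> Uset (diagm lam) \<and> (gam has_vector_derivative toda (gam t)) (at t))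
      \<longrightarrow> (\<forall>t\<in>{a<..<b}. ((\<lambda>s. phiYZ (diagm lam) (gam s)) has_vector_derivative
                            linYZ lam (phiYZ (diagm lam) (gam t))) (at t))"
    using phiYZ_toda_has_vector_derivative[OF simple inslc[unfolded Lam_def]] by blast
next
  show "\<forall>Y\<in>aff (diagm lam). \<forall>Z\<in>aff (diagm lam).
      fst (linYZ lam (Y, Z)) \<in> lalg \<and> snd (linYZ lam (Y, Z)) \<in> lalg"
    unfolding linYZ_eq fst_conv snd_conv using comm_diagm_lalg by blast
next
  show "\<forall>Y0\<in>aff (diagm lam). \<forall>Z0\<in>aff (diagm lam). \<exists>c :: real \<Rightarrow> 'n cmat \<times> 'n cmat. c 0 = (Y0, Z0) \<and>
      (\<forall>t. c t \<in> aff (diagm lam) \<times> aff (diagm lam) \<and> (c has_vector_derivative linYZ lam (c t)) (at t))"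
  proof (intro ballI)
    fix Y0 Z0 assume Y0: "Y0 \<in> aff (diagm lam)" and Z0: "Z0 \<in> aff (diagm lam)"
    \<comment> \<open>The shift by \<open>0\<close> matches
      \<open>flow_has_vector_derivative\<close>, which is stated for an arbitrary base time.\<close>
    define c where "c t = (flow (imdiag lam) (t - 0) Y0, flow (negrediag lam) (t - 0) Z0)" for t
    have "(c has_vector_derivative linYZ lam (c t)) (at t)" for t
      unfolding c_def[abs_def] linYZ_eq fst_conv snd_conv
      by (intro has_vector_derivative_Pair flow_has_vector_derivative)
    moreover have "c t \<in> aff (diagm lam) \<times> aff (diagm lam)" for t
      using Y0 Z0 by (simp add: c_def flow_aff)
    moreover have "c 0 = (Y0, Z0)"
      by (simp add: c_def flow_0)
    ultimately show "\<exists>c :: real \<Rightarrow> 'n cmat \<times> 'n cmat. c 0 = (Y0, Z0) \<and>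
      (\<forall>t. c t \<in> aff (diagm lam) \<times> aff (diagm lam) \<and> (c has_vector_derivative linYZ lam (c t)) (at t))"
      by blast
  qed
next
  show "\<forall>c :: real \<Rightarrow> 'n cmat \<times> 'n cmat.
      (\<forall>t. c t \<in> aff (diagm lam) \<times> aff (diagm lam) \<and> (c has_vector_derivative linYZ lam (c t)) (at t)) \<longrightarrow>
      compact (closure (range (\<lambda>t. fst (c t)))) \<and>
      (compact (range (\<lambda>t. snd (c t))) \<longleftrightarrow> (\<forall>t. snd (c t) = snd (c 0)))"
  proof (intro allI impI conjI)
    fix c :: "real \<Rightarrow> 'n cmat \<times> 'n cmat"
    assume "\<forall>t. c t \<in> aff (diagm lam) \<times> aff (diagm lam) \<and> (c has_vector_derivative linYZ lam (c t)) (at t)"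
    then have c: "(c has_vector_derivative linYZ lam (c t)) (at t)" for t
      by blast
    have fst: "(\<lambda>t. fst (c t)) = (\<lambda>t. flow (imdiag lam) t (fst (c 0)))"
      and snd: "(\<lambda>t. snd (c t)) = (\<lambda>t. flow (negrediag lam) t (snd (c 0)))"
      by (rule ext, rule linYZ_trajectory_eq_flow[OF c])+
    show "compact (closure (range (\<lambda>t. fst (c t))))"
      unfolding fst by (rule compact_closure_imaginary_flow)
    show "compact (range (\<lambda>t. snd (c t))) \<longleftrightarrow> (\<forall>t. snd (c t) = snd (c 0))"
    proof
      assume "compact (range (\<lambda>t. snd (c t)))"
      then have "bounded (range (\<lambda>t. flow (negrediag lam) t (snd (c 0))))"
        unfolding snd by (rule compact_imp_bounded)
      then show "\<forall>t. snd (c t) = snd (c 0)"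
        using linYZ_trajectory_eq_flow(2)[OF c, THEN trans] bounded_real_flow_stationary by blast
    next
      assume "\<forall>t. snd (c t) = snd (c 0)"
      then have "range (\<lambda>t. snd (c t)) = {snd (c 0)}"
        by auto
      then show "compact (range (\<lambda>t. snd (c t)))"
        by simp
    qed
  qed
next
  show "\<exists>f g :: 'n \<Rightarrow> 'n \<Rightarrow> complex \<Rightarrow> complex.
      \<forall>Y\<in>aff (diagm lam). \<forall>Z\<in>aff (diagm lam). \<forall>j k. k < j \<longrightarrow>
        fst (linYZ lam (Y, Z)) $ j $ k = f j k (Y $ j $ k) \<and>
        snd (linYZ lam (Y, Z)) $ j $ k = g j k (Z $ j $ k)"
    \<comment> \<open>A commutator with a diagonal matrix acts diagonally on entries; the witnesses
      multiply by differences of the diagonal entries.\<close>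
    by (rule exI[of _ "\<lambda>j k y. y * (imdiag lam k - imdiag lam j)"],
        rule exI[of _ "\<lambda>j k z. z * (negrediag lam k - negrediag lam j)"])
      (simp add: linYZ_eq comm_diagm_nth)
qed

end
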